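(* Let $d\ge 1$, $K\in\{2d,2d+1\}$, $p\in[0,1]$, $\theta\in(0,1]$, and let $(S_n)_{n\in\mathbb{N}}$ be the position of the $d$-dimensional walk with memory and random tendency with parameters $K,p,\theta$. Let $\widehat S_n=S_n-\mathbb{E}(S_n)$ and $a=\frac{Kp-1}{K-1}$. If $p>\frac{K+2\theta-1}{2\theta K}$, then there is a non-degenerate random vector $L$ in $\mathbb{R}^d$ such that, almost surely, $$\lim_{n\to\infty}\frac{\widehat S_n}{n^{a\theta}}=L,$$ and moreover the convergence also holds in mean square: $$\lim_{n\to\infty}\mathbb{E}\left(\left\|\frac{\widehat S_n}{n^{a\theta}}-L\right\|^2\right)=0 .$$
   Context: Model (walk with memory and random tendency). Let $d\ge1$ and let $(e_1,\ldots,e_d)$ be the canonical basis of $\mathbb{R}^d$. The set of directions is $E_d=\{e_1,-e_1,\ldots,e_d,-e_d\}$ if $K=2d$, and $E_d=\{e_1,-e_1,\ldots,e_d,-e_d,\mathbf{0}\}$ if $K=2d+1$ (where $\mathbf{0}$ means no movement); thus $|E_d|=K$. The steps $X_1,X_2,\ldots$ take values in $E_d$, and $S_n=\sum_{i=1}^n X_i\in\mathbb{R}^d$ (column vector). The first step $X_1$ has an arbitrary distribution on $E_d$. Let $(Y_n)_{n\ge1}$ be i.i.d. Bernoulli random variables with parameter $\theta$ (i.e. $P(Y_n=1)=\theta$), with $Y_n$ independent of $X_1,\ldots,X_n$. Given $X_1,\ldots,X_n$ ($n\ge1$), the step $X_{n+1}$ is generated as follows: - if $Y_n=1$, choose $t\in\{1,\ldots,n\}$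 uniformly at random (independently of everything else); then $X_{n+1}=X_t$ with probability $p$, and $X_{n+1}$ equals each of the other $K-1$ elements of $E_d$ with probability $\frac{1-p}{K-1}$; - if $Y_n=0$, then $X_{n+1}=e_1$ with probability $p$, and $X_{n+1}$ equals each of the other $K-1$ elements of $E_d$ with probability $\frac{1-p}{K-1}$. A random vector is non-degenerate if it is not almost surely equal to a constant vector. $\|\cdot\|$ is the Euclidean norm.
   Formalization: Non-degeneracy of L is claimed except when p=1 and either X_1=e_1 almost surely, or θ=1 and X_1 is almost surely constant; there the walk is deterministic, so L=0 and the claim as stated fails. Both convergences are claimed in all cases. *)

theory Defs
  imports "HOL-Probability.Probability"
begin

text \<open>
  The dimension \<open>d\<close> is \<open>CARD('d)\<close>. An index type has no distinguished first element, so the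
  preferred direction (\<open>e\<^sub>1\<close>) is \<open>axis i1 1\<close> for an arbitrary but fixed coordinate \<open>i1\<close>.
\<close>

definition directions :: "nat \<Rightarrow> (real ^ 'd) set" where
  "directions K =
     range (\<lambda>i. axis i 1) \<union> range (\<lambda>i. - axis i 1) \<union> (if K = 2 * CARD('d) + 1 then {0} else {})"

definition step_law :: "nat \<Rightarrow> real \<Rightarrow> real ^ 'd \<Rightarrow> real ^ 'd \<Rightarrow> real" where
  "step_law K p v z = (if z = v then p else (1 - p) / (real K - 1))"

text \<open>
  The sigma-algebra generated by a random variable \<open>Z\<close> with values in \<open>N\<close>; the library's
  \<open>indep_var\<close> relates only variables with the same value type, hence the use of \<open>indep_set\<close>.
\<close>

definition generated_events :: "'w measure \<Rightarrow> ('w \<Rightarrow> 'b) \<Rightarrow> 'b measure \<Rightarrow> 'w set set" where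
  "generated_events M Z N = sets (vimage_algebra (space M) Z N)"

text \<open>
  The step \<open>X (n + 1)\<close> uses the coin \<open>Y n\<close> (with \<open>True\<close> for the value 1) and the remembered
  time \<open>T n\<close>. Conditional laws are elementary conditional probabilities given a history
  \<open>X 1 = x 1, \<dots>, X n = x n\<close>; since \<open>cond_prob\<close> is 0 for a null condition, they are only imposed
  for conditions of positive probability. Nothing is assumed about the law of \<open>X 1\<close>, and
  independence of \<open>T n\<close> is only required from \<open>X 1, \<dots>, X n, Y n\<close>, which already
  determines the law of the walk.
\<close>

locale memory_tendency_walk = prob_space M
  for M :: "'w measure" +
  fixes K :: nat and p \<theta> :: real and i1 :: "'d::finite"
    and X :: "nat \<Rightarrow> 'w \<Rightarrow> real ^ 'd" and Y :: "nat \<Rightarrow> 'w \<Rightarrow> bool" and T :: "nat \<Rightarrow> 'w \<Rightarrow> nat"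
  assumes X_directions: "\<And>n. n \<ge> 1 \<Longrightarrow> X n \<in> measurable M (count_space (directions K))"
    and Y_indep: "indep_vars (\<lambda>_. count_space UNIV) Y {1..}"
    and Y_bernoulli:
      "\<And>n. n \<ge> 1 \<Longrightarrow> distr M (count_space UNIV) (Y n) = measure_pmf (bernoulli_pmf \<theta>)"
    and Y_indep_X:
      "\<And>n. n \<ge> 1 \<Longrightarrow> indep_set (generated_events M (Y n) (count_space UNIV))
         (generated_events M (\<lambda>\<omega>. \<lambda>i\<in>{1..n}. X i \<omega>)
           (Pi\<^sub>M {1..n} (\<lambda>_. count_space (directions K))))"
    and T_uniform:
      "\<And>n. n \<ge> 1 \<Longrightarrow> distr M (count_space UNIV) (T n) = measure_pmf (pmf_of_set {1..n})"
    and T_indep: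
      "\<And>n. n \<ge> 1 \<Longrightarrow> indep_set (generated_events M (T n) (count_space UNIV))
         (generated_events M (\<lambda>\<omega>. (\<lambda>i\<in>{1..n}. X i \<omega>, Y n \<omega>))
           (Pi\<^sub>M {1..n} (\<lambda>_. count_space (directions K)) \<Otimes>\<^sub>M count_space UNIV))"
    and step_memory:
      "\<And>n x t z. n \<ge> 1 \<Longrightarrow> t \<in> {1..n} \<Longrightarrow> z \<in> directions K \<Longrightarrow>
         \<P>(\<omega> in M. (\<forall>i\<in>{1..n}. X i \<omega> = x i) \<and> Y n \<omega> \<and> T n \<omega> = t) > 0 \<Longrightarrow>
         \<P>(\<omega> in M. X (n + 1) \<omega> = z \<bar> (\<forall>i\<in>{1..n}. X i \<omega> = x i) \<and> Y n \<omega> \<and> T n \<omega> = t)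
           = step_law K p (x t) z"
    and step_tendency:
      "\<And>n x z. n \<ge> 1 \<Longrightarrow> z \<in> directions K \<Longrightarrow>
         \<P>(\<omega> in M. (\<forall>i\<in>{1..n}. X i \<omega> = x i) \<and> \<not> Y n \<omega>) > 0 \<Longrightarrow>
         \<P>(\<omega> in M. X (n + 1) \<omega> = z \<bar> (\<forall>i\<in>{1..n}. X i \<omega> = x i) \<and> \<not> Y n \<omega>)
           = step_law K p (axis i1 1) z"

definition position :: "(nat \<Rightarrow> 'w \<Rightarrow> real ^ 'd) \<Rightarrow> nat \<Rightarrow> 'w \<Rightarrow> real ^ 'd" where
  "position X n \<omega> = (\<Sum>i=1..n. X i \<omega>)"

definition centered_position ::
    "'w measure \<Rightarrow> (nat \<Rightarrow> 'w \<Rightarrow> real ^ 'd) \<Rightarrow> nat \<Rightarrow> 'w \<Rightarrow> real ^ 'd" where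
  "centered_position M X n \<omega> = position X n \<omega> - integral\<^sup>L M (position X n)"

definition nondegenerate :: "'w measure \<Rightarrow> ('w \<Rightarrow> real ^ 'd) \<Rightarrow> bool" where
  "nondegenerate M Z \<longleftrightarrow> \<not> (\<exists>c. AE \<omega> in M. Z \<omega> = c)"

text \<open>
  The cases in which the whole walk is almost surely deterministic, so that the centered position
  vanishes and no non-degenerate limit exists: no step ever deviates (\<open>p = 1\<close>), and either the
  walk starts in the preferred direction, or the tendency is never used (\<open>\<theta> = 1\<close>) and the first
  step is constant.
\<close>

definition deterministic_case ::
    "'w measure \<Rightarrow> real \<Rightarrow> real \<Rightarrow> 'd::finite \<Rightarrow> (nat \<Rightarrow> 'w \<Rightarrow> real ^ 'd) \<Rightarrow> bool" where
  "deterministic_case M p \<theta> i1 X \<longleftrightarrow>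
     p = 1 \<and> ((AE \<omega> in M. X 1 \<omega> = axis i1 1) \<or> \<theta> = 1 \<and> \<not> nondegenerate M (X 1))"

end

(*
  Put b = a * \<theta>, so that 1/2 < b. Conditioning on the first n steps gives each coordinate of the
  next step the mean (b / n) S_n + const. Hence the centered position divided by
  u_n = (1 + b/1) ... (1 + b/(n-1)) is a martingale whose increments are O(1 / u_n) = O(n^(-b)),
  which is square summable because 2b > 1. Square-summable martingale differences have almost surely
  and L^2 convergent partial sums (Kolmogorov's maximal inequality), and n^b / u_n tends to
  b Gamma(b). The variances of the increments add up in the limit, so a constant limit forces the
  first two steps to be almost surely constant, which happens only for a deterministic walk.
*)
theory Submission
  imports Defs
begin

section \<open>Square-summable martingale differences\<close>

text \<open>The centered position divided by n^b is not exactly a martingale; dividing by u_n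
  removes the factor 1 + b/n by which one step multiplies the conditional mean, and the power of n
  enters only through a deterministic ratio. The hypotheses give elementary conditional
  probabilities. These suffice because a history takes finitely many values: each event of the
  filtration is a finite disjoint union of cylinders, and the martingale property becomes an
  identity of integrals over cylinders. The abstract part therefore states centering as vanishing
  integrals over events of \<open>F n\<close>. It is scalar, since the mean of the next step acts on
  each coordinate separately, and is applied once per coordinate. One quantity, the tail of the
  series of second moments, controls the almost sure convergence, the mean-square error and the
  argument for non-degeneracy. The constant a arises because \<open>step_law\<close> is a constant
  on all directions plus an excess a at the target, and the constant part has mean zero by
  symmetry.\<close>

locale martingale_differences = prob_space M for M :: "'w measure" +
  fixes F :: "nat \<Rightarrow> 'w measure" and D :: "nat \<Rightarrow> 'w \<Rightarrow> real"
  assumes F_subalgebra: "\<And>n. subalgebra M (F n)"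
    and F_mono: "\<And>n. sets (F n) \<subseteq> sets (F (Suc n))"
    and D_measurable: "\<And>n. D n \<in> borel_measurable (F (Suc n))"
    and D_square_integrable: "\<And>n. integrable M (\<lambda>\<omega>. (D n \<omega>)\<^sup>2)"
    and D_centered: "\<And>n A. A \<in> sets (F n) \<Longrightarrow> (\<integral>\<omega>\<in>A. D n \<omega> \<partial>M) = 0"
begin

section \<open>Orthogonality and second moments of partial sums\<close>

definition partial_sum :: "nat \<Rightarrow> 'w \<Rightarrow> real" where
  "partial_sum n \<omega> = (\<Sum>k<n. D k \<omega>)"

lemma borel_measurable_F_mono:
  assumes "f \<in> borel_measurable (F m)" "m \<le> n"
  shows "f \<in> borel_measurable (F n)"
proof -
  have "sets (F m) \<subseteq> sets (F n)"
    using F_mono lift_Suc_mono_le[of "\<lambda>n. sets (F n)"] assms(2) by blast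
  moreover have "space (F m) = space (F n)"
    using F_subalgebra by (simp add: subalgebra_def)
  ultimately have "subalgebra (F n) (F m)"
    by (simp add: subalgebra_def)
  then show ?thesis
    using assms(1) by (rule measurable_from_subalg)
qed

lemma borel_measurable_F_M: "f \<in> borel_measurable (F n) \<Longrightarrow> f \<in> borel_measurable M"
  using F_subalgebra by (rule measurable_from_subalg)

lemma D_measurable_M [measurable]: "D n \<in> borel_measurable M"
  using D_measurable by (rule borel_measurable_F_M)

lemma partial_sum_measurable_F: "partial_sum n \<in> borel_measurable (F n)"
  unfolding partial_sum_def
  by (intro borel_measurable_sum borel_measurable_F_mono[OF D_measurable]) auto

lemma partial_sum_measurable_M [measurable]: "partial_sum n \<in> borel_measurable M"
  using partial_sum_measurable_F by (rule borel_measurable_F_M)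

lemma integrable_mult_of_squares:
  fixes f g :: "'w \<Rightarrow> real"
  assumes [measurable]: "f \<in> borel_measurable M" "g \<in> borel_measurable M"
    and "integrable M (\<lambda>\<omega>. (f \<omega>)\<^sup>2)" "integrable M (\<lambda>\<omega>. (g \<omega>)\<^sup>2)"
  shows "integrable M (\<lambda>\<omega>. f \<omega> * g \<omega>)"
proof (rule Bochner_Integration.integrable_bound)
  show "integrable M (\<lambda>\<omega>. (f \<omega>)\<^sup>2 + (g \<omega>)\<^sup>2)"
    using assms by simp
  have "\<bar>x * y\<bar> \<le> x\<^sup>2 + y\<^sup>2" for x y :: real
    using sum_squares_bound[of "\<bar>x\<bar>" "\<bar>y\<bar>"] mult_nonneg_nonneg[of "\<bar>x\<bar>" "\<bar>y\<bar>"]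
    unfolding abs_mult power2_abs by linarith
  then show "AE \<omega> in M. norm (f \<omega> * g \<omega>) \<le> norm ((f \<omega>)\<^sup>2 + (g \<omega>)\<^sup>2)"
    by (auto intro!: AE_I2)
qed measurable

lemma integrable_D: "integrable M (D n)"
  by (rule square_integrable_imp_integrable[OF D_measurable_M D_square_integrable])

text \<open>By \<open>D_centered\<close>, the conditional expectation of \<open>D n\<close> given
  \<open>F n\<close> is 0 almost everywhere, and a factor known at time n can be moved into it. All
  cross terms in second moments vanish for this reason.\<close>

lemma D_orthogonal:
  assumes f: "f \<in> borel_measurable (F n)" and sq: "integrable M (\<lambda>\<omega>. (f \<omega>)\<^sup>2)"
  shows "(\<integral>\<omega>. f \<omega> * D n \<omega> \<partial>M) = 0"
proof -
  interpret finite_measure_subalgebra M "F n"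
    by unfold_locales (rule F_subalgebra)
  have "AE \<omega> in M. real_cond_exp M (F n) (D n) \<omega> = 0"
    by (rule real_cond_exp_charact) (simp_all add: D_centered integrable_D)
  then have "(\<integral>\<omega>. f \<omega> * real_cond_exp M (F n) (D n) \<omega> \<partial>M) = 0"
    by (intro integral_eq_zero_AE) auto
  then show ?thesis
    using real_cond_exp_intg(2)[OF integrable_mult_of_squares[OF borel_measurable_F_M[OF f]
          D_measurable_M sq D_square_integrable] f D_measurable_M] by simp
qed

lemma partial_sum_second_moment:
  shows partial_sum_square_integrable: "integrable M (\<lambda>\<omega>. (partial_sum n \<omega>)\<^sup>2)"
    and partial_sum_square_integral: "(\<integral>\<omega>. (partial_sum n \<omega>)\<^sup>2 \<partial>M) = (\<Sum>k<n. \<integral>\<omega>. (D k \<omega>)\<^sup>2 \<partial>M)"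
proof (induction n)
  case 0
  { case 1 show ?case by (simp add: partial_sum_def) }
  { case 2 show ?case by (simp add: partial_sum_def) }
next
  case (Suc n)
  have eq: "(partial_sum (Suc n) \<omega>)\<^sup>2 = (partial_sum n \<omega>)\<^sup>2 + 2 * (partial_sum n \<omega> * D n \<omega>) + (D n \<omega>)\<^sup>2" for \<omega>
    by (simp add: partial_sum_def power2_sum)
  have int: "integrable M (\<lambda>\<omega>. partial_sum n \<omega> * D n \<omega>)"
    by (intro integrable_mult_of_squares Suc D_square_integrable) auto
  { case 1 show ?case
      unfolding eq using Suc int D_square_integrable by simp }
  { case 2 show ?case
      unfolding eq using Suc int D_square_integrable
        D_orthogonal[OF partial_sum_measurable_F Suc.IH(1)] by simp }
qed

text \<open>A weight known at time n keeps \<open>D n\<close> centered given \<open>F n\<close>, and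
  the bound 1 keeps it square integrable. Deterministic weights will cut off initial terms; random
  ones will stop the sum.\<close>

lemma predictable_transform:
  assumes V: "\<And>n. V n \<in> borel_measurable (F n)" and le: "\<And>n \<omega>. \<bar>V n \<omega>\<bar> \<le> (1::real)"
  shows "martingale_differences M F (\<lambda>n \<omega>. V n \<omega> * D n \<omega>)"
proof unfold_locales
  fix n
  note [measurable] = borel_measurable_F_M[OF V]
  show "(\<lambda>\<omega>. V n \<omega> * D n \<omega>) \<in> borel_measurable (F (Suc n))"
    by (intro borel_measurable_times D_measurable borel_measurable_F_mono[OF V]) simp
  have "(V n \<omega>)\<^sup>2 \<le> 1" for \<omega>
    using le[of n \<omega>] by (simp add: abs_square_le_1)
  then have "(V n \<omega> * D n \<omega>)\<^sup>2 \<le> (D n \<omega>)\<^sup>2" for \<omega>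
    by (metis mult_left_le_one_le power_mult_distrib zero_le_power2)
  then show "integrable M (\<lambda>\<omega>. (V n \<omega> * D n \<omega>)\<^sup>2)"
    by (intro Bochner_Integration.integrable_bound[OF D_square_integrable[of n]]) auto
  fix A assume A: "A \<in> sets (F n)"
  have "(\<integral>\<omega>\<in>A. V n \<omega> * D n \<omega> \<partial>M) = (\<integral>\<omega>. (indicator A \<omega> * V n \<omega>) * D n \<omega> \<partial>M)"
    by (simp add: set_lebesgue_integral_def mult.assoc)
  also have "\<dots> = 0"
  proof (rule D_orthogonal)
    show m: "(\<lambda>\<omega>. indicator A \<omega> * V n \<omega>) \<in> borel_measurable (F n)"
      using A V by simp
    note [measurable] = borel_measurable_F_M[OF m]
    have "\<bar>indicator A \<omega> * V n \<omega>\<bar> \<le> 1" for \<omega>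
      using le[of n \<omega>] by (simp add: indicator_def)
    then have sq_le: "(indicator A \<omega> * V n \<omega>)\<^sup>2 \<le> 1" for \<omega>
      by (simp add: abs_square_le_1)
    show "integrable M (\<lambda>\<omega>. (indicator A \<omega> * V n \<omega>)\<^sup>2)"
      by (rule Bochner_Integration.integrable_bound[of M "\<lambda>_. 1::real"]) (auto simp: sq_le)
  qed
  finally show "(\<integral>\<omega>\<in>A. V n \<omega> * D n \<omega> \<partial>M) = 0" .
qed (rule F_subalgebra F_mono)+

text \<open>The weights \<open>of_bool (m \<le> k)\<close> turn the increment from m to n into a
  partial sum of martingale differences, so the second moment formula applies to it.\<close>

lemma increment_square:
  shows increment_square_integrable: "integrable M (\<lambda>\<omega>. (partial_sum n \<omega> - partial_sum m \<omega>)\<^sup>2)"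
    and increment_square_integral:
      "m \<le> n \<Longrightarrow> (\<integral>\<omega>. (partial_sum n \<omega> - partial_sum m \<omega>)\<^sup>2 \<partial>M) = (\<Sum>k=m..<n. \<integral>\<omega>. (D k \<omega>)\<^sup>2 \<partial>M)"
proof -
  have int: "integrable M (\<lambda>\<omega>. partial_sum n \<omega> * partial_sum m \<omega>)"
    by (intro integrable_mult_of_squares partial_sum_square_integrable) auto
  have eq: "(partial_sum n \<omega> - partial_sum m \<omega>)\<^sup>2 = (partial_sum n \<omega>)\<^sup>2 + (partial_sum m \<omega>)\<^sup>2 - 2 * (partial_sum n \<omega> * partial_sum m \<omega>)" for \<omega>
    by (simp add: power2_diff)
  show "integrable M (\<lambda>\<omega>. (partial_sum n \<omega> - partial_sum m \<omega>)\<^sup>2)"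
    unfolding eq using int partial_sum_square_integrable by simp
  assume "m \<le> n"
  interpret late: martingale_differences M F "\<lambda>k \<omega>. of_bool (m \<le> k) * D k \<omega>"
    by (rule predictable_transform) auto
  have "late.partial_sum n \<omega> = partial_sum n \<omega> - partial_sum m \<omega>" for \<omega>
  proof -
    have "late.partial_sum n \<omega> = (\<Sum>k\<in>{m..<n}. D k \<omega>)"
      unfolding late.partial_sum_def by (rule sum.mono_neutral_cong_right) auto
    also have "\<dots> = partial_sum n \<omega> - partial_sum m \<omega>"
      using \<open>m \<le> n\<close> sum_diff_nat_ivl[of 0 m n "\<lambda>k. D k \<omega>"] by (simp add: partial_sum_def atLeast0LessThan)
    finally show ?thesis .
  qed
  then have "(\<integral>\<omega>. (partial_sum n \<omega> - partial_sum m \<omega>)\<^sup>2 \<partial>M) = (\<Sum>k<n. \<integral>\<omega>. (of_bool (m \<le> k) * D k \<omega>)\<^sup>2 \<partial>M)"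
    using late.partial_sum_square_integral[of n] by simp
  also have "\<dots> = (\<Sum>k=m..<n. \<integral>\<omega>. (D k \<omega>)\<^sup>2 \<partial>M)"
    by (rule sum.mono_neutral_cong_right) auto
  finally show "(\<integral>\<omega>. (partial_sum n \<omega> - partial_sum m \<omega>)\<^sup>2 \<partial>M) = (\<Sum>k=m..<n. \<integral>\<omega>. (D k \<omega>)\<^sup>2 \<partial>M)" .
qed

text \<open>Kolmogorov's inequality, by second moments of the sum stopped at the first exceedance of \<open>e\<close>.\<close>

lemma maximal_inequality:
  assumes "0 < e" "m \<le> N"
  shows "prob {\<omega>\<in>space M. \<exists>n\<in>{m..N}. e \<le> \<bar>partial_sum n \<omega> - partial_sum m \<omega>\<bar>}
    \<le> (\<Sum>k=m..<N. \<integral>\<omega>. (D k \<omega>)\<^sup>2 \<partial>M) / e\<^sup>2"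
proof -
  \<comment> \<open>\<open>V k\<close> is 1 as long as no exceedance has occurred at the times m to
    k, so whether \<open>D k\<close> is added depends only on the past. The value 0 before m makes
    the stopped sum start from 0 at time m.\<close>
  define V where "V k \<omega> = (of_bool (m \<le> k \<and> (\<forall>j\<in>{m..k}. \<bar>partial_sum j \<omega> - partial_sum m \<omega>\<bar> < e)) :: real)" for k \<omega>
  have V_measurable: "V k \<in> borel_measurable (F k)" for k
  proof (cases "m \<le> k")
    case True
    have [measurable]: "partial_sum m \<in> borel_measurable (F k)"
      and partial_sum_j: "\<And>j. j \<in> {m..k} \<Longrightarrow> partial_sum j \<in> borel_measurable (F k)"
      using True by (auto intro: borel_measurable_F_mono[OF partial_sum_measurable_F])
    have "{\<omega>\<in>space (F k). \<forall>j\<in>{m..k}. \<bar>partial_sum j \<omega> - partial_sum m \<omega>\<bar> < e} \<in> sets (F k)"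
    proof (rule sets.sets_Collect_finite_All')
      fix j assume "j \<in> {m..k}"
      note [measurable] = partial_sum_j[OF this]
      show "{\<omega>\<in>space (F k). \<bar>partial_sum j \<omega> - partial_sum m \<omega>\<bar> < e} \<in> sets (F k)" by measurable
    qed (use True in auto)
    then have [measurable]: "Measurable.pred (F k) (\<lambda>\<omega>. \<forall>j\<in>{m..k}. \<bar>partial_sum j \<omega> - partial_sum m \<omega>\<bar> < e)"
      by (simp add: pred_def)
    show ?thesis unfolding V_def by measurable
  next
    case False
    then have "V k = (\<lambda>_. 0)" by (simp add: V_def fun_eq_iff)
    then show ?thesis by simp
  qed
  interpret stopped: martingale_differences M F "\<lambda>k \<omega>. V k \<omega> * D k \<omega>"
    by (rule predictable_transform[OF V_measurable]) (simp add: V_def)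
  have V_0: "V k \<omega> = 0" if "k < m" for k \<omega> using that by (simp add: V_def)
  \<comment> \<open>Before an exceedance the stopped sum equals the increment since m; afterwards it
    is frozen at a value of modulus at least e. An exceedance anywhere between m and N is therefore
    visible at time N alone.\<close>
  have stop: "((\<forall>j\<in>{m..n}. \<bar>partial_sum j \<omega> - partial_sum m \<omega>\<bar> < e) \<longrightarrow> stopped.partial_sum n \<omega> = partial_sum n \<omega> - partial_sum m \<omega>) \<and>
     ((\<exists>j\<in>{m..n}. e \<le> \<bar>partial_sum j \<omega> - partial_sum m \<omega>\<bar>) \<longrightarrow> e \<le> \<bar>stopped.partial_sum n \<omega>\<bar>)" if "m \<le> n" for n \<omega>
    using that
  proof (induction n rule: dec_induct)
    case base
    show ?case using \<open>0 < e\<close> by (auto simp: stopped.partial_sum_def V_0)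
  next
    case (step n)
    have st: "stopped.partial_sum (Suc n) \<omega> = stopped.partial_sum n \<omega> + V n \<omega> * D n \<omega>"
      and w: "partial_sum (Suc n) \<omega> = partial_sum n \<omega> + D n \<omega>"
      by (simp_all add: stopped.partial_sum_def partial_sum_def)
    have set: "{m..Suc n} = insert (Suc n) {m..n}" using step by auto
    show ?case
    proof (cases "\<forall>j\<in>{m..n}. \<bar>partial_sum j \<omega> - partial_sum m \<omega>\<bar> < e")
      case True
      then have "V n \<omega> = 1" using step by (simp add: V_def)
      then have "stopped.partial_sum (Suc n) \<omega> = partial_sum (Suc n) \<omega> - partial_sum m \<omega>"
        using st w step True by simp
      then show ?thesis using True set by force
    next
      case False
      then have "V n \<omega> = 0" by (auto simp: V_def)
      then show ?thesis
        using st step.IH False set by (auto simp: not_less)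
    qed
  qed
  have "prob {\<omega>\<in>space M. \<exists>n\<in>{m..N}. e \<le> \<bar>partial_sum n \<omega> - partial_sum m \<omega>\<bar>} \<le> prob {\<omega>\<in>space M. e\<^sup>2 \<le> (stopped.partial_sum N \<omega>)\<^sup>2}"
  proof (rule finite_measure_mono)
    show "{\<omega>\<in>space M. \<exists>n\<in>{m..N}. e \<le> \<bar>partial_sum n \<omega> - partial_sum m \<omega>\<bar>} \<subseteq> {\<omega>\<in>space M. e\<^sup>2 \<le> (stopped.partial_sum N \<omega>)\<^sup>2}"
      using stop[OF \<open>m \<le> N\<close>] \<open>0 < e\<close> abs_le_square_iff[of e] by auto
  qed measurable
  also have "\<dots> \<le> (\<integral>\<omega>. (stopped.partial_sum N \<omega>)\<^sup>2 \<partial>M) / e\<^sup>2"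
    by (rule integral_Markov_inequality_measure[where A="{}"])
      (use stopped.partial_sum_square_integrable \<open>0 < e\<close> in auto)
  also have "(\<integral>\<omega>. (stopped.partial_sum N \<omega>)\<^sup>2 \<partial>M) = (\<Sum>k=m..<N. \<integral>\<omega>. (V k \<omega> * D k \<omega>)\<^sup>2 \<partial>M)"
    unfolding stopped.partial_sum_square_integral by (rule sum.mono_neutral_right) (auto simp: V_0)
  also have "\<dots> \<le> (\<Sum>k=m..<N. \<integral>\<omega>. (D k \<omega>)\<^sup>2 \<partial>M)"
    by (intro sum_mono integral_mono D_square_integrable stopped.D_square_integrable)
      (simp add: V_def)
  finally show ?thesis by (simp add: divide_right_mono)
qed

end

section \<open>Almost sure and mean-square limits\<close>

locale square_summable_martingale_differences = martingale_differences +
  assumes summable_D: "summable (\<lambda>k. \<integral>\<omega>. (D k \<omega>)\<^sup>2 \<partial>M)"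
begin

text \<open>\<open>lim\<close> makes this total; the value where the partial sums diverge is
  arbitrary and concerns only a null set.\<close>

definition sum_limit :: "'a \<Rightarrow> real" where
  "sum_limit \<omega> = lim (\<lambda>n. partial_sum n \<omega>)"

text \<open>By orthogonality this bounds the second moment of every increment starting at time m,
  uniformly in its end.\<close>

definition tail_variance :: "nat \<Rightarrow> real" where
  "tail_variance m = (\<Sum>k. \<integral>\<omega>. (D (k + m) \<omega>)\<^sup>2 \<partial>M)"

lemma tail_variance_tendsto: "tail_variance \<longlonglongrightarrow> 0"
  unfolding tail_variance_def using summable_D by (rule suminf_exist_split2)

text \<open>The left side is an initial part of a series of nonnegative terms. With n = m the lemma
  also yields nonnegativity of the tail.\<close>

lemma tail_variance_ge:
  "(\<Sum>k=m..<n. \<integral>\<omega>. (D k \<omega>)\<^sup>2 \<partial>M) \<le> tail_variance m"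
proof -
  have "(\<Sum>k=m..<n. \<integral>\<omega>. (D k \<omega>)\<^sup>2 \<partial>M) = (\<Sum>k<n-m. \<integral>\<omega>. (D (k + m) \<omega>)\<^sup>2 \<partial>M)"
    by (subst sum.atLeastLessThan_shift_0) (simp add: atLeast0LessThan add.commute)
  also have "\<dots> \<le> tail_variance m"
    unfolding tail_variance_def
    by (intro sum_le_suminf) (auto simp: summable_iff_shift[of "\<lambda>k. \<integral>\<omega>. (D k \<omega>)\<^sup>2 \<partial>M"] summable_D)
  finally show ?thesis .
qed

text \<open>Bounding the sum in \<open>maximal_inequality\<close> by the full tail makes it
  independent of the horizon N, so the estimate passes to the increasing union over N.\<close>

lemma oscillation_bound:
  assumes "0 < e"
  shows "prob {\<omega>\<in>space M. \<exists>n\<ge>m. e \<le> \<bar>partial_sum n \<omega> - partial_sum m \<omega>\<bar>} \<le> tail_variance m / e\<^sup>2"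
proof -
  let ?A = "\<lambda>N. {\<omega>\<in>space M. \<exists>n\<in>{m..N}. e \<le> \<bar>partial_sum n \<omega> - partial_sum m \<omega>\<bar>}"
  have "(\<lambda>N. prob (?A N)) \<longlonglongrightarrow> prob (\<Union>N. ?A N)"
    by (rule finite_Lim_measure_incseq) (auto simp: incseq_def intro: order_trans)
  moreover have "prob (?A N) \<le> tail_variance m / e\<^sup>2" if "m \<le> N" for N
    using maximal_inequality[OF \<open>0 < e\<close> that] tail_variance_ge[of m N]
    by (meson divide_right_mono order_trans zero_le_power2)
  ultimately have "prob (\<Union>N. ?A N) \<le> tail_variance m / e\<^sup>2"
    by (intro LIMSEQ_le_const2) auto
  also have "(\<Union>N. ?A N) = {\<omega>\<in>space M. \<exists>n\<ge>m. e \<le> \<bar>partial_sum n \<omega> - partial_sum m \<omega>\<bar>}"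
    using atLeastAtMost_iff by blast
  finally show ?thesis .
qed

text \<open>The exceptional event lies in the oscillation event of every m, whose probability is at
  most \<open>tail_variance m / e\<^sup>2\<close> and hence tends to 0.\<close>

lemma AE_oscillation:
  assumes "0 < e"
  shows "AE \<omega> in M. \<exists>m. \<forall>n\<ge>m. \<bar>partial_sum n \<omega> - partial_sum m \<omega>\<bar> < e"
proof -
  define B where "B = {\<omega>\<in>space M. \<forall>m. \<exists>n\<ge>m. e \<le> \<bar>partial_sum n \<omega> - partial_sum m \<omega>\<bar>}"
  have [measurable]: "B \<in> events" unfolding B_def by measurable
  have "prob B \<le> tail_variance m / e\<^sup>2" for m
  proof -
    have "prob B \<le> prob {\<omega>\<in>space M. \<exists>n\<ge>m. e \<le> \<bar>partial_sum n \<omega> - partial_sum m \<omega>\<bar>}"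
      by (rule finite_measure_mono) (auto simp: B_def)
    then show ?thesis using oscillation_bound[OF assms, of m] by linarith
  qed
  moreover have "(\<lambda>m. tail_variance m / e\<^sup>2) \<longlonglongrightarrow> 0"
    using tendsto_divide_zero[OF tail_variance_tendsto] .
  ultimately have "prob B \<le> 0"
    by (intro LIMSEQ_le_const) auto
  then have "AE \<omega> in M. \<omega> \<notin> B"
    using prob_eq_0[of B] measure_nonneg[of M B] by simp
  then show ?thesis
    using AE_space
  proof eventually_elim
    case (elim \<omega>)
    then show ?case
      by (simp add: B_def linorder_not_le imp_conv_disj)
  qed
qed

lemma AE_partial_sum_tendsto: "AE \<omega> in M. (\<lambda>n. partial_sum n \<omega>) \<longlonglongrightarrow> sum_limit \<omega>"
proof -
  \<comment> \<open>Countably many thresholds suffice for the Cauchy property, so the exceptional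
    null sets can be combined.\<close>
  have "AE \<omega> in M. \<forall>j. \<exists>m. \<forall>n\<ge>m. \<bar>partial_sum n \<omega> - partial_sum m \<omega>\<bar> < 1 / real (Suc j)"
    by (subst AE_all_countable) (auto intro: AE_oscillation)
  then show ?thesis
  proof eventually_elim
    case (elim \<omega>)
    have "Cauchy (\<lambda>n. partial_sum n \<omega>)"
      unfolding Cauchy_altdef2
    proof (intro allI impI)
      fix e :: real assume "0 < e"
      then obtain j where j: "1 / real (Suc j) < e"
        using nat_approx_posE by blast
      obtain m where "\<And>n. n \<ge> m \<Longrightarrow> \<bar>partial_sum n \<omega> - partial_sum m \<omega>\<bar> < 1 / real (Suc j)"
        using elim by blast
      then show "\<exists>N. \<forall>n\<ge>N. dist (partial_sum n \<omega>) (partial_sum N \<omega>) < e"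
        using j by (auto simp: dist_real_def intro: less_trans)
    qed
    then show ?case
      unfolding sum_limit_def using Cauchy_convergent_iff convergent_LIMSEQ_iff by blast
  qed
qed

lemma sum_limit_measurable [measurable]: "sum_limit \<in> borel_measurable M"
  unfolding sum_limit_def by measurable

text \<open>Fatou's lemma for the increments from m to n as n grows. The nonnegative integral is
  used because square integrability of the limit is itself deduced from this bound, at m =
  0.\<close>

lemma sum_limit_L2_bound: "(\<integral>\<^sup>+\<omega>. ennreal ((partial_sum m \<omega> - sum_limit \<omega>)\<^sup>2) \<partial>M) \<le> ennreal (tail_variance m)"
proof -
  have "(\<integral>\<^sup>+\<omega>. ennreal ((partial_sum m \<omega> - sum_limit \<omega>)\<^sup>2) \<partial>M)
      = (\<integral>\<^sup>+\<omega>. liminf (\<lambda>n. ennreal ((partial_sum n \<omega> - partial_sum m \<omega>)\<^sup>2)) \<partial>M)"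
  proof (rule nn_integral_cong_AE)
    show "AE \<omega> in M. ennreal ((partial_sum m \<omega> - sum_limit \<omega>)\<^sup>2) = liminf (\<lambda>n. ennreal ((partial_sum n \<omega> - partial_sum m \<omega>)\<^sup>2))"
      using AE_partial_sum_tendsto
    proof eventually_elim
      case (elim \<omega>)
      have "(\<lambda>n. ennreal ((partial_sum n \<omega> - partial_sum m \<omega>)\<^sup>2)) \<longlonglongrightarrow> ennreal ((sum_limit \<omega> - partial_sum m \<omega>)\<^sup>2)"
        by (intro tendsto_intros elim)
      then show ?case
        using lim_imp_Liminf[OF sequentially_bot] by (metis power2_commute)
    qed
  qed
  also have "\<dots> \<le> liminf (\<lambda>n. \<integral>\<^sup>+\<omega>. ennreal ((partial_sum n \<omega> - partial_sum m \<omega>)\<^sup>2) \<partial>M)"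
    by (rule nn_integral_liminf) measurable
  also have "\<dots> \<le> ennreal (tail_variance m)"
  proof (rule Liminf_le)
    show "\<forall>\<^sub>F n in sequentially. (\<integral>\<^sup>+\<omega>. ennreal ((partial_sum n \<omega> - partial_sum m \<omega>)\<^sup>2) \<partial>M) \<le> ennreal (tail_variance m)"
      using eventually_ge_at_top[of m]
    proof eventually_elim
      case (elim n)
      then show ?case
        using increment_square_integral[OF elim] tail_variance_ge[of m n]
        by (subst nn_integral_eq_integral[OF increment_square_integrable])
           (auto intro!: ennreal_leI)
    qed
  qed simp
  finally show ?thesis .
qed

lemma sum_limit_square_integrable: "integrable M (\<lambda>\<omega>. (sum_limit \<omega>)\<^sup>2)"
proof (rule integrableI_bounded)
  have "(\<integral>\<^sup>+\<omega>. ennreal (norm ((sum_limit \<omega>)\<^sup>2)) \<partial>M) = (\<integral>\<^sup>+\<omega>. ennreal ((partial_sum 0 \<omega> - sum_limit \<omega>)\<^sup>2) \<partial>M)"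
    by (simp add: partial_sum_def)
  also have "\<dots> \<le> ennreal (tail_variance 0)" by (rule sum_limit_L2_bound)
  also have "\<dots> < \<infinity>" by simp
  finally show "(\<integral>\<^sup>+\<omega>. ennreal (norm ((sum_limit \<omega>)\<^sup>2)) \<partial>M) < \<infinity>" .
qed measurable

text \<open>Partial sums have mean 0, so subtracting c can only increase their second moment. For n
  > k the second moment of \<open>D k\<close> is thus at most that of
  \<open>partial_sum n - c\<close>, which is at most \<open>tail_variance n\<close> and tends to
  0.\<close>

lemma sum_limit_constant_imp_D_zero:
  assumes "AE \<omega> in M. sum_limit \<omega> = c"
  shows "AE \<omega> in M. D k \<omega> = 0"
proof -
  have E_D: "(\<integral>\<omega>. D k \<omega> \<partial>M) = 0" for k
    using D_centered[of "space M" k] F_subalgebra[of k] sets.top[of "F k"]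
    by (simp add: subalgebra_def set_lebesgue_integral_def indicator_times_eq_if
        cong: Bochner_Integration.integral_cong)
  have int_partial_sum: "integrable M (partial_sum n)" and E_partial_sum: "(\<integral>\<omega>. partial_sum n \<omega> \<partial>M) = 0" for n
    using integrable_D E_D unfolding partial_sum_def[abs_def] by (auto simp: Bochner_Integration.integral_sum)
  have "(\<integral>\<omega>. (D k \<omega>)\<^sup>2 \<partial>M) \<le> tail_variance n" if "k < n" for n
  proof -
    have sq: "(partial_sum n \<omega> - c)\<^sup>2 = (partial_sum n \<omega>)\<^sup>2 - 2 * c * partial_sum n \<omega> + c\<^sup>2" for \<omega>
      by (simp add: power2_diff)
    have int: "integrable M (\<lambda>\<omega>. (partial_sum n \<omega> - c)\<^sup>2)"
      unfolding sq using partial_sum_square_integrable int_partial_sum by simp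
    have "(\<integral>\<omega>. (D k \<omega>)\<^sup>2 \<partial>M) \<le> (\<Sum>j<n. \<integral>\<omega>. (D j \<omega>)\<^sup>2 \<partial>M)"
      using that by (intro member_le_sum) auto
    also have "\<dots> \<le> (\<integral>\<omega>. (partial_sum n \<omega> - c)\<^sup>2 \<partial>M)"
      unfolding sq using partial_sum_square_integrable int_partial_sum E_partial_sum by (simp add: partial_sum_square_integral prob_space)
    also have "ennreal (\<integral>\<omega>. (partial_sum n \<omega> - c)\<^sup>2 \<partial>M) = (\<integral>\<^sup>+\<omega>. ennreal ((partial_sum n \<omega> - sum_limit \<omega>)\<^sup>2) \<partial>M)"
      using assms by (subst nn_integral_eq_integral[OF int, symmetric])
        (auto intro!: nn_integral_cong_AE elim!: AE_mp)
    then have "(\<integral>\<omega>. (partial_sum n \<omega> - c)\<^sup>2 \<partial>M) \<le> tail_variance n"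
      using sum_limit_L2_bound[of n] tail_variance_ge[of n n] by (simp flip: ennreal_le_iff)
    finally show ?thesis .
  qed
  then have "(\<integral>\<omega>. (D k \<omega>)\<^sup>2 \<partial>M) \<le> 0"
    by (intro LIMSEQ_le_const[OF tail_variance_tendsto]) (auto intro!: exI[of _ "Suc k"])
  then have "(\<integral>\<omega>. (D k \<omega>)\<^sup>2 \<partial>M) = 0"
    by (simp add: order_antisym)
  then show ?thesis
    using integral_nonneg_eq_0_iff_AE[OF D_square_integrable] by simp
qed

end

section \<open>Law of one step given the history\<close>

lemma finite_directions: "finite (directions K :: (real ^ 'd::finite) set)"
  by (simp add: directions_def)

lemma uminus_in_directions: "z \<in> directions K \<Longrightarrow> - z \<in> directions K"
  by (auto simp: directions_def)

lemma axis_in_directions: "axis i 1 \<in> directions K"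
  by (simp add: directions_def)

lemma directions_component_le_1: "z \<in> directions K \<Longrightarrow> \<bar>z $ i\<bar> \<le> 1"
  by (auto simp: directions_def axis_def split: if_splits)

text \<open>The set of directions is invariant under negation, with or without the zero vector, so
  the sum equals its own negative.\<close>

lemma sum_directions: "(\<Sum>z\<in>directions K. z $ i) = 0"
proof -
  have "(\<Sum>z\<in>directions K. z $ i) = (\<Sum>z\<in>directions K. (- z) $ i)"
    by (rule sum.reindex_bij_witness[of _ uminus uminus]) (auto simp: uminus_in_directions)
  then show ?thesis by (simp add: sum_negf)
qed

text \<open>The law is the constant \<open>?q\<close> on all directions plus an excess
  \<open>p - ?q\<close> at v. The constant part has mean zero, and the excess is the parameter a of
  the theorem.\<close>

lemma step_law_mean:
  assumes "v \<in> directions K" "K \<ge> 2"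
  shows "(\<Sum>z\<in>directions K. z $ i * step_law K p v z) = (real K * p - 1) / (real K - 1) * v $ i"
proof -
  let ?q = "(1 - p) / (real K - 1)"
  have "z $ i * step_law K p v z = ?q * z $ i + (if z = v then (p - ?q) * v $ i else 0)" for z
    by (simp add: step_law_def algebra_simps)
  then have "(\<Sum>z\<in>directions K. z $ i * step_law K p v z) = (p - ?q) * v $ i"
    using assms(1)
    by (simp only: sum.distrib sum_distrib_left[symmetric] sum_directions) (simp add: sum.delta finite_directions)
  also have "p - ?q = (real K * p - 1) / (real K - 1)"
    using assms(2) by (simp add: field_simps)
  finally show ?thesis .
qed

text \<open>Law of total probability. The values are confined to I almost surely only, as is the
  case for the remembered time \<open>T n\<close>.\<close>

lemma (in finite_measure) measure_eq_sum_fibres: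
  assumes "finite I" "A \<in> sets M" "\<And>t. t \<in> I \<Longrightarrow> {\<omega>\<in>space M. Z \<omega> = t} \<in> sets M"
    and "AE \<omega> in M. Z \<omega> \<in> I"
  shows "measure M A = (\<Sum>t\<in>I. measure M (A \<inter> {\<omega>\<in>space M. Z \<omega> = t}))"
proof -
  have "measure M A = measure M (\<Union>t\<in>I. A \<inter> {\<omega>\<in>space M. Z \<omega> = t})"
  proof (rule finite_measure_eq_AE)
    show "AE \<omega> in M. \<omega> \<in> A \<longleftrightarrow> \<omega> \<in> (\<Union>t\<in>I. A \<inter> {\<omega>\<in>space M. Z \<omega> = t})"
      using assms(4) by eventually_elim (use sets.sets_into_space[OF assms(2)] in auto)
  qed (use assms in auto)
  also have "\<dots> = (\<Sum>t\<in>I. measure M (A \<inter> {\<omega>\<in>space M. Z \<omega> = t}))"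
    using assms by (intro finite_measure_finite_Union) (auto simp: disjoint_family_on_def)
  finally show ?thesis .
qed

section \<open>Histories, cylinders and the filtration\<close>

context memory_tendency_walk
begin

text \<open>\<open>restrict\<close> gives an extensional function, so two histories are equal
  exactly when the steps 1 to n agree, and the values lie in the finite set
  \<open>paths n\<close>.\<close>

definition history :: "nat \<Rightarrow> 'w \<Rightarrow> nat \<Rightarrow> real ^ 'd" where
  "history n \<omega> = (\<lambda>i\<in>{1..n}. X i \<omega>)"

definition paths :: "nat \<Rightarrow> (nat \<Rightarrow> real ^ 'd) set" where
  "paths n = {1..n} \<rightarrow>\<^sub>E directions K"

definition cylinder :: "nat \<Rightarrow> (nat \<Rightarrow> real ^ 'd) \<Rightarrow> 'w set" where
  "cylinder n x = {\<omega>\<in>space M. \<forall>i\<in>{1..n}. X i \<omega> = x i}"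

definition path_algebra :: "nat \<Rightarrow> (nat \<Rightarrow> real ^ 'd) measure" where
  "path_algebra n = Pi\<^sub>M {1..n} (\<lambda>_. count_space (directions K))"

text \<open>For n = 0 there is only one history, so \<open>F 0\<close> is trivial and the first
  martingale difference will be a coordinate of \<open>X 1\<close> minus its mean.\<close>

definition F :: "nat \<Rightarrow> 'w measure" where
  "F n = vimage_algebra (space M) (history n) (path_algebra n)"

lemma finite_paths: "finite (paths n)"
  unfolding paths_def by (intro finite_PiE finite_directions) simp

lemma space_path_algebra: "space (path_algebra n) = paths n"
  by (simp add: path_algebra_def paths_def space_PiM)

text \<open>This makes the cylinders measurable: finitely many atoms on which the conditional means
  are computed.\<close>

lemma singleton_path: "x \<in> paths n \<Longrightarrow> {x} \<in> sets (path_algebra n)"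
proof -
  assume x: "x \<in> paths n"
  then have "x \<in> extensional {1..n}"
    by (simp add: paths_def PiE_iff)
  then have "{x} = (\<Pi>\<^sub>E i\<in>{1..n}. {x i})"
    by (rule PiE_singleton[symmetric])
  also have "\<dots> \<in> sets (path_algebra n)"
    unfolding path_algebra_def using x
    by (intro sets_PiM_I_finite) (auto simp: paths_def)
  finally show ?thesis .
qed

lemma X_in_directions: "n \<ge> 1 \<Longrightarrow> \<omega> \<in> space M \<Longrightarrow> X n \<omega> \<in> directions K"
  using measurable_space[OF X_directions] by simp

lemma history_in_paths: "\<omega> \<in> space M \<Longrightarrow> history n \<omega> \<in> paths n"
  by (auto simp: history_def paths_def X_in_directions)

lemma history_measurable: "history n \<in> measurable M (path_algebra n)"
  unfolding history_def[abs_def] path_algebra_def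
  by (rule measurable_restrict) (simp add: X_directions)

lemma history_eq_iff: "\<omega> \<in> space M \<Longrightarrow> x \<in> paths n \<Longrightarrow> history n \<omega> = x \<longleftrightarrow> \<omega> \<in> cylinder n x"
  by (auto simp: history_def cylinder_def paths_def fun_eq_iff PiE_def extensional_def)

lemma cylinder_eq_vimage: "x \<in> paths n \<Longrightarrow> cylinder n x = history n -` {x} \<inter> space M"
  using history_eq_iff[of _ x n] by (auto simp: cylinder_def)

lemma sets_F: "sets (F n) = generated_events M (\<lambda>\<omega>. \<lambda>i\<in>{1..n}. X i \<omega>) (Pi\<^sub>M {1..n} (\<lambda>_. count_space (directions K)))"
  by (simp add: F_def generated_events_def history_def[abs_def] path_algebra_def)

lemma space_F: "space (F n) = space M"
  by (simp add: F_def)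

lemma history_measurable_F: "history n \<in> measurable (F n) (path_algebra n)"
  unfolding F_def by (rule measurable_vimage_algebra1) (simp add: space_path_algebra history_in_paths)

lemma cylinder_in_F: "x \<in> paths n \<Longrightarrow> cylinder n x \<in> sets (F n)"
  unfolding cylinder_eq_vimage F_def by (intro in_vimage_algebra singleton_path)

lemma sets_F_eq: "sets (F n) = {history n -` B \<inter> space M | B. B \<in> sets (path_algebra n)}"
  unfolding F_def by (rule sets_vimage_algebra2) (simp add: space_path_algebra history_in_paths)

lemma subalgebra_F: "subalgebra M (F n)"
  using measurable_sets[OF history_measurable] by (auto simp: subalgebra_def space_F sets_F_eq)

lemma cylinder_in_events [measurable]: "x \<in> paths n \<Longrightarrow> cylinder n x \<in> events"
  using cylinder_in_F[of x n] subalgebra_F[of n] by (auto simp: subalgebra_def)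

lemma F_Suc: "sets (F n) \<subseteq> sets (F (Suc n))"
proof
  fix A assume "A \<in> sets (F n)"
  then obtain B where B: "B \<in> sets (path_algebra n)" and A: "A = history n -` B \<inter> space M"
    by (auto simp: sets_F_eq)
  have "history n = (\<lambda>\<omega>. restrict (history (Suc n) \<omega>) {1..n})"
    by (auto simp: history_def fun_eq_iff)
  moreover have "(\<lambda>\<omega>. restrict (history (Suc n) \<omega>) {1..n}) \<in> measurable (F (Suc n)) (path_algebra n)"
    unfolding path_algebra_def
    by (intro measurable_compose[OF history_measurable_F[unfolded path_algebra_def]] measurable_restrict_subset) auto
  ultimately have "history n \<in> measurable (F (Suc n)) (path_algebra n)" by simp
  from measurable_sets[OF this B] show "A \<in> sets (F (Suc n))"
    by (simp add: A space_F)
qed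

lemma X_measurable_F:
  assumes "1 \<le> k" "k \<le> n"
  shows "X k \<in> measurable (F n) (count_space (directions K))"
proof -
  have "(\<lambda>\<omega>. history n \<omega> k) \<in> measurable (F n) (count_space (directions K))"
    using assms by (intro measurable_compose[OF history_measurable_F])
      (auto simp: path_algebra_def intro!: measurable_component_singleton)
  then show ?thesis using assms by (simp add: history_def)
qed

lemma X_component_measurable_F:
  "1 \<le> k \<Longrightarrow> k \<le> n \<Longrightarrow> (\<lambda>\<omega>. X k \<omega> $ i) \<in> borel_measurable (F n)"
  by (rule measurable_compose[OF X_measurable_F]) auto

lemma X_component_measurable [measurable]: "(\<lambda>\<omega>. X (Suc k) \<omega> $ i) \<in> borel_measurable M"
  by (rule measurable_from_subalg[OF subalgebra_F X_component_measurable_F[of "Suc k" "Suc k"]]) auto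

lemma X_eq_in_events: "n \<ge> 1 \<Longrightarrow> {\<omega>\<in>space M. X n \<omega> = z} \<in> events"
proof (cases "z \<in> directions K")
  case True
  assume "n \<ge> 1"
  then have "X n -` {z} \<inter> space M \<in> events"
    using True by (intro measurable_sets[OF X_directions]) auto
  also have "X n -` {z} \<inter> space M = {\<omega>\<in>space M. X n \<omega> = z}" by auto
  finally show ?thesis .
next
  case False
  assume "n \<ge> 1"
  then have empty: "{\<omega>\<in>space M. X n \<omega> = z} = {}" using False X_in_directions by blast
  show ?thesis unfolding empty by simp
qed

section \<open>Coin, remembered time and the law of the next step\<close>

lemma Y_measurable: "n \<ge> 1 \<Longrightarrow> Y n \<in> measurable M (count_space UNIV)"
  using Y_indep by (auto simp: indep_vars_def)

lemma Y_event: "n \<ge> 1 \<Longrightarrow> {\<omega>\<in>space M. Y n \<omega> = y} \<in> generated_events M (Y n) (count_space UNIV)"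
  using in_vimage_algebra[of "{y}" "count_space UNIV" "Y n" "space M"]
  by (simp add: generated_events_def vimage_def Int_def conj_commute)

lemma T_event: "{\<omega>\<in>space M. T n \<omega> = t} \<in> generated_events M (T n) (count_space UNIV)"
  using in_vimage_algebra[of "{t}" "count_space UNIV" "T n" "space M"]
  by (simp add: generated_events_def vimage_def Int_def conj_commute)

text \<open>Independence of two families of sets includes that their members are events;
  \<open>T_indep\<close> supplies the measurability in this way.\<close>

lemma T_measurable: "n \<ge> 1 \<Longrightarrow> T n \<in> measurable M (count_space UNIV)"
proof (rule measurableI)
  fix A assume "n \<ge> 1"
  then show "T n -` A \<inter> space M \<in> events"
    using indep_setD_ev1[OF T_indep] in_vimage_algebra[of A "count_space UNIV" "T n" "space M"]
    unfolding generated_events_def by auto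
qed simp

lemma prob_T: "n \<ge> 1 \<Longrightarrow> t \<in> {1..n} \<Longrightarrow> prob {\<omega>\<in>space M. T n \<omega> = t} = 1 / n"
proof -
  assume n: "n \<ge> 1" and t: "t \<in> {1..n}"
  have "prob (T n -` {t} \<inter> space M) = measure (measure_pmf (pmf_of_set {1..n})) {t}"
    using measure_distr[OF T_measurable[OF n], of "{t}"] T_uniform[OF n] by simp
  also have "\<dots> = 1 / n" using n t by (simp add: measure_pmf_single)
  finally show ?thesis by (simp add: vimage_def Int_def conj_commute)
qed

lemma AE_T: "n \<ge> 1 \<Longrightarrow> AE \<omega> in M. T n \<omega> \<in> {1..n}"
proof -
  assume n: "n \<ge> 1"
  have "AE t in distr M (count_space UNIV) (T n). t \<in> {1..n}"
    unfolding T_uniform[OF n] using n by (subst AE_measure_pmf_iff) auto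
  then show ?thesis
    using n by (subst (asm) AE_distr_iff) (auto simp: T_measurable)
qed

lemma prob_Y:
  assumes "0 \<le> \<theta>" "\<theta> \<le> 1" "n \<ge> 1"
  shows "prob {\<omega>\<in>space M. Y n \<omega> = y} = (if y then \<theta> else 1 - \<theta>)"
proof -
  have "prob (Y n -` {y} \<inter> space M) = measure (measure_pmf (bernoulli_pmf \<theta>)) {y}"
    using measure_distr[OF Y_measurable[OF assms(3)], of "{y}"] Y_bernoulli[OF assms(3)] by simp
  also have "\<dots> = (if y then \<theta> else 1 - \<theta>)" using assms by (simp add: measure_pmf_single)
  finally show ?thesis by (simp add: vimage_def Int_def conj_commute)
qed

lemma prob_cylinder_Y:
  assumes "0 \<le> \<theta>" "\<theta> \<le> 1" "n \<ge> 1" "x \<in> paths n"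
  shows "prob (cylinder n x \<inter> {\<omega>\<in>space M. Y n \<omega> = y}) = (if y then \<theta> else 1 - \<theta>) * prob (cylinder n x)"
  using indep_setD[OF Y_indep_X[OF assms(3)] Y_event[OF assms(3), of y]
      cylinder_in_F[OF assms(4), unfolded sets_F]] prob_Y[OF assms(1-3), of y]
  by (simp add: Int_commute)

text \<open>\<open>T_indep\<close> concerns the pair of history and coin, so cylinder and coin event
  are written as one preimage under \<open>?Z\<close>; \<open>prob_cylinder_Y\<close> then splits
  off the coin.\<close>

lemma prob_cylinder_Y_T:
  assumes "0 \<le> \<theta>" "\<theta> \<le> 1" "n \<ge> 1" "x \<in> paths n" "t \<in> {1..n}"
  shows "prob (cylinder n x \<inter> {\<omega>\<in>space M. Y n \<omega>} \<inter> {\<omega>\<in>space M. T n \<omega> = t}) = \<theta> / n * prob (cylinder n x)"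
proof -
  let ?Z = "\<lambda>\<omega>. (\<lambda>i\<in>{1..n}. X i \<omega>, Y n \<omega>)"
  have "?Z -` ({x} \<times> {True}) \<inter> space M
      \<in> generated_events M ?Z (Pi\<^sub>M {1..n} (\<lambda>_. count_space (directions K)) \<Otimes>\<^sub>M count_space UNIV)"
    unfolding generated_events_def
    using singleton_path[OF assms(4), unfolded path_algebra_def]
    by (intro in_vimage_algebra pair_measureI) auto
  also have "?Z -` ({x} \<times> {True}) \<inter> space M = cylinder n x \<inter> {\<omega>\<in>space M. Y n \<omega>}"
    using cylinder_eq_vimage[OF assms(4)] by (auto simp: history_def)
  finally have ev: "cylinder n x \<inter> {\<omega>\<in>space M. Y n \<omega>} \<in> generated_events M ?Z
      (Pi\<^sub>M {1..n} (\<lambda>_. count_space (directions K)) \<Otimes>\<^sub>M count_space UNIV)" .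
  show ?thesis
    using indep_setD[OF T_indep[OF assms(3)] T_event ev, of t] prob_T[OF assms(3,5)]
      prob_cylinder_Y[OF assms(1-4), of True]
    by (simp add: Int_commute)
qed

text \<open>Total probability over the coin and, if it shows \<open>True\<close>, over the
  remembered time. The product form, instead of a conditional probability, also covers histories of
  probability 0.\<close>

lemma step_probability:
  assumes \<theta>: "0 \<le> \<theta>" "\<theta> \<le> 1" and n: "n \<ge> 1" and x: "x \<in> paths n" and z: "z \<in> directions K"
  shows "prob (cylinder n x \<inter> {\<omega>\<in>space M. X (n + 1) \<omega> = z}) =
    prob (cylinder n x) * (\<theta> / n * (\<Sum>t=1..n. step_law K p (x t) z) + (1 - \<theta>) * step_law K p (axis i1 1) z)"
proof -
  define E where "E = cylinder n x"
  define Z where "Z = {\<omega>\<in>space M. X (n + 1) \<omega> = z}"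
  have meas [measurable]: "E \<in> events" "Z \<in> events" "\<And>y. {\<omega>\<in>space M. Y n \<omega> = y} \<in> events"
      "\<And>t. {\<omega>\<in>space M. T n \<omega> = t} \<in> events"
    using x n Y_event[OF n] indep_setD_ev1[OF Y_indep_X[OF n]] T_event indep_setD_ev1[OF T_indep[OF n]]
    by (auto simp: E_def Z_def X_eq_in_events)
  have Y_True: "{\<omega>\<in>space M. Y n \<omega> = True} = {\<omega>\<in>space M. Y n \<omega>}"
    and Y_False: "{\<omega>\<in>space M. Y n \<omega> = False} = {\<omega>\<in>space M. \<not> Y n \<omega>}" by auto
  have memory: "prob (E \<inter> Z \<inter> {\<omega>\<in>space M. Y n \<omega>} \<inter> {\<omega>\<in>space M. T n \<omega> = t})
      = step_law K p (x t) z * (\<theta> / n * prob E)" if t: "t \<in> {1..n}" for t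
  proof -
    let ?C = "E \<inter> {\<omega>\<in>space M. Y n \<omega>} \<inter> {\<omega>\<in>space M. T n \<omega> = t}"
    have C: "?C = {\<omega>\<in>space M. (\<forall>i\<in>{1..n}. X i \<omega> = x i) \<and> Y n \<omega> \<and> T n \<omega> = t}"
      by (auto simp: E_def cylinder_def)
    have ZC: "E \<inter> Z \<inter> {\<omega>\<in>space M. Y n \<omega>} \<inter> {\<omega>\<in>space M. T n \<omega> = t}
       = {\<omega>\<in>space M. X (n + 1) \<omega> = z \<and> (\<forall>i\<in>{1..n}. X i \<omega> = x i) \<and> Y n \<omega> \<and> T n \<omega> = t}"
      by (auto simp: E_def Z_def cylinder_def)
    have pC: "prob ?C = \<theta> / n * prob E"
      unfolding E_def by (rule prob_cylinder_Y_T[OF \<theta> n x t])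
    show ?thesis
    \<comment> \<open>The step law is imposed only for conditions of positive probability. Otherwise
      both sides are 0, the event on the left being contained in \<open>?C\<close>.\<close>
    proof (cases "prob ?C > 0")
      case True
      then have "prob (E \<inter> Z \<inter> {\<omega>\<in>space M. Y n \<omega>} \<inter> {\<omega>\<in>space M. T n \<omega> = t}) / prob ?C = step_law K p (x t) z"
        using step_memory[OF n t z, of x] unfolding cond_prob_def C[symmetric] ZC[symmetric] by simp
      then show ?thesis
        using True unfolding pC by (simp only: nonzero_divide_eq_eq[OF less_imp_neq[THEN not_sym]])
    next
      case False
      have "prob (E \<inter> Z \<inter> {\<omega>\<in>space M. Y n \<omega>} \<inter> {\<omega>\<in>space M. T n \<omega> = t}) \<le> prob ?C"
        using meas(3)[of True] unfolding Y_True by (intro finite_measure_mono) auto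
      moreover have "prob ?C = 0"
        using False measure_nonneg[of M ?C] by linarith
      ultimately show ?thesis
        using measure_nonneg[of M "E \<inter> Z \<inter> {\<omega>\<in>space M. Y n \<omega>} \<inter> {\<omega>\<in>space M. T n \<omega> = t}"]
        unfolding pC[symmetric] by simp
    qed
  qed
  have tendency: "prob (E \<inter> Z \<inter> {\<omega>\<in>space M. \<not> Y n \<omega>}) = step_law K p (axis i1 1) z * ((1 - \<theta>) * prob E)"
  proof -
    let ?C = "E \<inter> {\<omega>\<in>space M. \<not> Y n \<omega>}"
    have C: "?C = {\<omega>\<in>space M. (\<forall>i\<in>{1..n}. X i \<omega> = x i) \<and> \<not> Y n \<omega>}"
      by (auto simp: E_def cylinder_def)
    have ZC: "E \<inter> Z \<inter> {\<omega>\<in>space M. \<not> Y n \<omega>}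
       = {\<omega>\<in>space M. X (n + 1) \<omega> = z \<and> (\<forall>i\<in>{1..n}. X i \<omega> = x i) \<and> \<not> Y n \<omega>}"
      by (auto simp: E_def Z_def cylinder_def)
    have pC: "prob ?C = (1 - \<theta>) * prob E"
      using prob_cylinder_Y[OF \<theta> n x, of False] by (simp add: E_def)
    show ?thesis
    proof (cases "prob ?C > 0")
      case True
      then have "prob (E \<inter> Z \<inter> {\<omega>\<in>space M. \<not> Y n \<omega>}) / prob ?C = step_law K p (axis i1 1) z"
        using step_tendency[OF n z, of x] unfolding cond_prob_def C[symmetric] ZC[symmetric] by simp
      then show ?thesis
        using True unfolding pC by (simp only: nonzero_divide_eq_eq[OF less_imp_neq[THEN not_sym]])
    next
      case False
      have "prob (E \<inter> Z \<inter> {\<omega>\<in>space M. \<not> Y n \<omega>}) \<le> prob ?C"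
        using meas(3)[of False] unfolding Y_False by (intro finite_measure_mono) auto
      moreover have "prob ?C = 0"
        using False measure_nonneg[of M ?C] by linarith
      ultimately show ?thesis
        using measure_nonneg[of M "E \<inter> Z \<inter> {\<omega>\<in>space M. \<not> Y n \<omega>}"]
        unfolding pC[symmetric] by simp
    qed
  qed
  have "prob (E \<inter> Z) = prob (E \<inter> Z \<inter> {\<omega>\<in>space M. Y n \<omega>}) + prob (E \<inter> Z \<inter> {\<omega>\<in>space M. \<not> Y n \<omega>})"
    using measure_eq_sum_fibres[of "UNIV :: bool set" "E \<inter> Z" "Y n"] meas(3)
    by (simp add: UNIV_bool)
  also have "prob (E \<inter> Z \<inter> {\<omega>\<in>space M. Y n \<omega>})
      = (\<Sum>t=1..n. prob (E \<inter> Z \<inter> {\<omega>\<in>space M. Y n \<omega>} \<inter> {\<omega>\<in>space M. T n \<omega> = t}))"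
    using meas(3)[of True] unfolding Y_True
    by (intro measure_eq_sum_fibres AE_T n) auto
  also have "\<dots> = prob E * (\<theta> / n * (\<Sum>t=1..n. step_law K p (x t) z))"
    by (simp add: memory sum_distrib_left mult_ac)
  finally show ?thesis
    unfolding tendency E_def[symmetric] Z_def[symmetric] by (simp add: algebra_simps)
qed

end

section \<open>Superdiffusive regime\<close>

locale superdiffusive_walk = memory_tendency_walk M K p \<theta> i1 X Y T
  for M :: "'w measure" and K p \<theta> and i1 :: "'d::finite" and X Y T +
  fixes a :: real
  assumes K_ge_2: "K \<ge> 2"
    and p_bounds: "0 \<le> p" "p \<le> 1"
    and \<theta>_bounds: "0 < \<theta>" "\<theta> \<le> 1"
    and a_eq: "a = (real K * p - 1) / (real K - 1)"
    and superdiffusive: "1 / 2 < a * \<theta>"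
begin

section \<open>Drift, normalising sequence and its growth\<close>

lemma a_bounds: "0 < a" "a \<le> 1"
proof -
  show "0 < a"
    using superdiffusive \<theta>_bounds by (smt (verit) mult_nonneg_nonneg mult_nonpos_nonneg divide_pos_pos)
  have "real K * p - 1 \<le> real K - 1"
    using p_bounds by (simp add: mult_left_le)
  then show "a \<le> 1"
    using K_ge_2 by (simp add: a_eq)
qed

lemma exponent_le_1: "a * \<theta> \<le> 1"
  using a_bounds \<theta>_bounds by (simp add: mult_le_one)

text \<open>Conditional mean of coordinate i of step n + 1 given the first n steps. At n = 0 nothing
  precedes the step, so its plain mean takes this role.\<close>

definition drift :: "'d \<Rightarrow> nat \<Rightarrow> 'w \<Rightarrow> real" where
  "drift i n \<omega> = (if n = 0 then \<integral>\<omega>. X 1 \<omega> $ i \<partial>M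
     else a * \<theta> / n * position X n \<omega> $ i + (1 - \<theta>) * a * axis i1 1 $ i)"

text \<open>With b = a * \<theta> and n \<ge> 1 this is Gamma(n + b) / (Gamma(n) Gamma(1 + b)). The
  product stops before n, so the values at 0 and 1 are both 1.\<close>

definition scale :: "nat \<Rightarrow> real" where
  "scale n = (\<Prod>k=1..<n. 1 + a * \<theta> / real k)"

text \<open>The index of \<open>scale\<close> is n + 1 because this is the change of the scaled
  centered position from time n to time n + 1.\<close>

definition innovation :: "'d \<Rightarrow> nat \<Rightarrow> 'w \<Rightarrow> real" where
  "innovation i n \<omega> = (X (Suc n) \<omega> $ i - drift i n \<omega>) / scale (Suc n)"

lemma scale_ge_1: "scale n \<ge> 1"
  unfolding scale_def using a_bounds \<theta>_bounds by (intro prod_ge_1) simp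

lemma scale_pos: "scale n > 0"
  using scale_ge_1[of n] by linarith

lemma scale_Suc: "n \<ge> 1 \<Longrightarrow> scale (Suc n) = scale n * (1 + a * \<theta> / n)"
  by (simp add: scale_def)

lemma scale_Suc_0 [simp]: "scale 0 = 1" "scale (Suc 0) = 1"
  by (simp_all add: scale_def)

text \<open>For n \<ge> 1, b (n - 1)! \<open>scale n\<close> is the rising factorial b (b + 1) ...
  (b + n - 1). Hence the ratio is b times the sequence \<open>Gamma_series'\<close>, which converges
  to Gamma(b).\<close>

lemma powr_div_scale_tendsto:
  "(\<lambda>n. real n powr (a * \<theta>) / scale n) \<longlonglongrightarrow> a * \<theta> * Gamma (a * \<theta>)"
proof -
  let ?b = "a * \<theta>"
  have b: "?b > 0" using a_bounds \<theta>_bounds by simp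
  have scale: "?b * fact (n - 1) * scale n = pochhammer ?b n" if "n \<ge> 1" for n
    using that
  proof (induction n rule: dec_induct)
    case base
    show ?case by simp
  next
    case (step n)
    then have "fact n = real n * fact (n - 1)" by (simp add: fact_reduce)
    then have "?b * fact (Suc n - 1) * scale (Suc n) = ?b * fact (n - 1) * scale n * (n * (1 + ?b / n))"
      using step.hyps by (simp add: scale_Suc mult_ac)
    also have "n * (1 + ?b / n) = ?b + n"
      using step.hyps by (simp add: field_simps)
    finally show ?case
      by (simp only: step.IH pochhammer_Suc)
  qed
  have "(\<lambda>n. ?b * Gamma_series' ?b n) \<longlonglongrightarrow> ?b * Gamma ?b"
    by (intro tendsto_intros Gamma_series'_LIMSEQ)
  moreover have "\<forall>\<^sub>F n in sequentially. ?b * Gamma_series' ?b n = real n powr ?b / scale n"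
    using eventually_ge_at_top[of 1]
  proof eventually_elim
    case (elim n)
    then show ?case
      using a_bounds \<theta>_bounds scale_pos[of n] unfolding Gamma_series'_def scale[OF elim, symmetric]
      by (simp add: powr_def mult_ac)
  qed
  ultimately show ?thesis by (rule Lim_transform_eventually)
qed

text \<open>The convergent ratio n^b / \<open>scale n\<close> is bounded by some C, which gives the
  comparison series of C^2 n^(-2b); it converges because 2b > 1.\<close>

lemma summable_inverse_scale_square: "summable (\<lambda>n. 1 / (scale n)\<^sup>2)"
proof -
  obtain C where C: "\<And>n. norm (real n powr (a * \<theta>) / scale n) \<le> C"
    using convergent_imp_Bseq[OF convergentI[OF powr_div_scale_tendsto]] by (auto simp: Bseq_def)
  have "summable (\<lambda>n. C\<^sup>2 * real n powr (- (2 * (a * \<theta>))))"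
    using superdiffusive by (intro summable_mult) (simp add: summable_real_powr_iff)
  then show ?thesis
  proof (rule summable_comparison_test_ev[rotated])
    show "\<forall>\<^sub>F n in sequentially. norm (1 / (scale n)\<^sup>2) \<le> C\<^sup>2 * real n powr (- (2 * (a * \<theta>)))"
      using eventually_ge_at_top[of 1]
    proof eventually_elim
      case (elim n)
      have "(real n powr (a * \<theta>) / scale n)\<^sup>2 \<le> C\<^sup>2"
        using C[of n] scale_pos[of n] by (intro power_mono) auto
      moreover have "(real n powr (a * \<theta>))\<^sup>2 = real n powr (2 * (a * \<theta>))"
        by (simp only: power2_eq_square powr_add[symmetric] mult_2)
      ultimately have "real n powr (2 * (a * \<theta>)) / (scale n)\<^sup>2 \<le> C\<^sup>2"
        by (simp add: power_divide)
      then show ?case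
        using elim scale_pos[of n] by (simp add: powr_minus field_simps)
    qed
  qed
qed

section \<open>Conditional mean of a step and the innovation martingale\<close>

lemma abs_X_le_1: "n \<ge> 1 \<Longrightarrow> \<omega> \<in> space M \<Longrightarrow> \<bar>X n \<omega> $ i\<bar> \<le> 1"
  by (rule directions_component_le_1[OF X_in_directions])

lemma integrable_X_component: "n \<ge> 1 \<Longrightarrow> integrable M (\<lambda>\<omega>. X n \<omega> $ i)"
  using abs_X_le_1 X_component_measurable[of "n - 1" i]
  by (intro integrable_const_bound[where B=1]) (auto intro!: AE_I2)

lemma position_component_measurable_F: "(\<lambda>\<omega>. position X n \<omega> $ i) \<in> borel_measurable (F n)"
  unfolding position_def sum_component
  by (intro borel_measurable_sum X_component_measurable_F) auto

lemma drift_measurable_F: "drift i n \<in> borel_measurable (F n)"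
  unfolding drift_def[abs_def] using position_component_measurable_F[of n i] by simp

lemma innovation_measurable_F: "innovation i n \<in> borel_measurable (F (Suc n))"
proof -
  have "drift i n \<in> borel_measurable (F (Suc n))"
    by (rule measurable_from_subalg[OF _ drift_measurable_F])
       (use F_Suc in \<open>simp add: subalgebra_def space_F\<close>)
  then show ?thesis
    unfolding innovation_def[abs_def]
    using X_component_measurable_F[of "Suc n" "Suc n" i] by simp
qed

lemma abs_position_le: "\<omega> \<in> space M \<Longrightarrow> \<bar>position X n \<omega> $ i\<bar> \<le> n"
proof -
  assume \<omega>: "\<omega> \<in> space M"
  have "\<bar>position X n \<omega> $ i\<bar> \<le> (\<Sum>k=1..n. \<bar>X k \<omega> $ i\<bar>)"
    unfolding position_def sum_component by (rule sum_abs)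
  also have "\<dots> \<le> (\<Sum>k=1..n. 1)"
    using \<omega> by (intro sum_mono abs_X_le_1) auto
  finally show ?thesis by simp
qed

text \<open>The memory term and the tendency term contribute at most 1 each; at n = 0 the bound 1 on
  a step is enough.\<close>

lemma abs_drift_le_2: "\<omega> \<in> space M \<Longrightarrow> \<bar>drift i n \<omega>\<bar> \<le> 2"
proof (cases "n = 0")
  case True
  have "\<bar>\<integral>\<omega>. X 1 \<omega> $ i \<partial>M\<bar> \<le> (\<integral>\<omega>. \<bar>X 1 \<omega> $ i\<bar> \<partial>M)"
    by (rule integral_abs_bound)
  also have "\<dots> \<le> (\<integral>\<omega>. 1 \<partial>M)"
    using integrable_X_component[of 1 i] by (intro integral_mono abs_X_le_1) auto
  finally show ?thesis using True by (simp add: drift_def prob_space)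
next
  case False
  assume \<omega>: "\<omega> \<in> space M"
  have "\<bar>a * \<theta> / n * position X n \<omega> $ i\<bar> = (a * \<theta>) * (\<bar>position X n \<omega> $ i\<bar> / n)"
    using a_bounds \<theta>_bounds by (simp add: abs_mult)
  also have "\<dots> \<le> 1"
    using exponent_le_1 abs_position_le[OF \<omega>, of n i] a_bounds \<theta>_bounds False
    by (intro mult_le_one) (auto simp: divide_le_eq)
  finally have "\<bar>a * \<theta> / n * position X n \<omega> $ i\<bar> \<le> 1" .
  moreover have "\<bar>(1 - \<theta>) * a * axis i1 1 $ i\<bar> \<le> 1"
    using a_bounds \<theta>_bounds by (simp add: abs_mult axis_def mult_le_one)
  ultimately show ?thesis unfolding drift_def if_not_P[OF False] by linarith
qed

text \<open>The transition law becomes the martingale property here: the integral is split by the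
  value of the next step, and each step law in \<open>step_probability\<close> is replaced by its
  mean.\<close>

lemma drift_cylinder:
  assumes n: "n \<ge> 1" and x: "x \<in> paths n"
  shows "(\<integral>\<omega>\<in>cylinder n x. X (Suc n) \<omega> $ i \<partial>M) = (\<integral>\<omega>\<in>cylinder n x. drift i n \<omega> \<partial>M)"
proof -
  let ?E = "cylinder n x"
  \<comment> \<open>The constant value of \<open>drift i n\<close> on this cylinder.\<close>
  define c where "c = \<theta> / n * (\<Sum>t=1..n. a * x t $ i) + (1 - \<theta>) * (a * axis i1 1 $ i)"
  note [measurable] = cylinder_in_events[OF x] X_eq_in_events
  have mean: "(\<Sum>z\<in>directions K. z $ i * step_law K p v z) = a * v $ i" if "v \<in> directions K" for v
    unfolding a_eq using step_law_mean[OF that K_ge_2] .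
  have "(\<integral>\<omega>\<in>?E. X (Suc n) \<omega> $ i \<partial>M)
      = (\<integral>\<omega>. (\<Sum>z\<in>directions K. z $ i * indicator (?E \<inter> {\<omega>\<in>space M. X (n + 1) \<omega> = z}) \<omega>) \<partial>M)"
    unfolding set_lebesgue_integral_def
  proof (rule Bochner_Integration.integral_cong)
    fix \<omega> assume \<omega>: "\<omega> \<in> space M"
    have "(\<Sum>z\<in>directions K. z $ i * indicator (?E \<inter> {\<omega>\<in>space M. X (n + 1) \<omega> = z}) \<omega>)
       = (\<Sum>z\<in>directions K. if X (n + 1) \<omega> = z then z $ i * indicator ?E \<omega> else 0)"
      using \<omega> by (intro sum.cong) (auto simp: indicator_def)
    then show "indicat_real ?E \<omega> *\<^sub>R X (Suc n) \<omega> $ i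
        = (\<Sum>z\<in>directions K. z $ i * indicator (?E \<inter> {\<omega>\<in>space M. X (n + 1) \<omega> = z}) \<omega>)"
      using X_in_directions[OF _ \<omega>, of "Suc n"] by (simp add: finite_directions)
  qed simp
  also have "\<dots> = (\<Sum>z\<in>directions K. z $ i * prob (?E \<inter> {\<omega>\<in>space M. X (n + 1) \<omega> = z}))"
  proof (subst Bochner_Integration.integral_sum)
    fix z
    have "?E \<inter> {\<omega>\<in>space M. X (n + 1) \<omega> = z} \<in> events"
      using cylinder_in_events[OF x] X_eq_in_events[of "n + 1" z] by (intro sets.Int) auto
    then show "integrable M (\<lambda>\<omega>. z $ i * indicator (?E \<inter> {\<omega>\<in>space M. X (n + 1) \<omega> = z}) \<omega>)"
      by (intro integrable_mult_right integrable_real_indicator) (auto simp: less_top[symmetric])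
  qed (auto intro!: sum.cong arg_cong[of _ _ prob])
  also have "\<dots> = (\<Sum>z\<in>directions K. prob ?E * (\<theta> / n * (\<Sum>t=1..n. z $ i * step_law K p (x t) z)
      + (1 - \<theta>) * (z $ i * step_law K p (axis i1 1) z)))"
  proof (rule sum.cong)
    fix z :: "real ^ 'd" assume "z \<in> directions K"
    then show "z $ i * prob (?E \<inter> {\<omega>\<in>space M. X (n + 1) \<omega> = z})
        = prob ?E * (\<theta> / n * (\<Sum>t=1..n. z $ i * step_law K p (x t) z)
          + (1 - \<theta>) * (z $ i * step_law K p (axis i1 1) z))"
      unfolding step_probability[OF less_imp_le[OF \<theta>_bounds(1)] \<theta>_bounds(2) n x \<open>z \<in> directions K\<close>]
      by (simp add: sum_distrib_left[symmetric] algebra_simps)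
  qed simp
  also have "\<dots> = prob ?E * (\<theta> / n * (\<Sum>t=1..n. \<Sum>z\<in>directions K. z $ i * step_law K p (x t) z)
      + (1 - \<theta>) * (\<Sum>z\<in>directions K. z $ i * step_law K p (axis i1 1) z))"
    \<comment> \<open>After the exchange the sum over directions is innermost, and each remembered
      time t contributes the mean of one step law.\<close>
    by (subst sum.swap) (simp only: sum.distrib sum_distrib_left[symmetric])
  also have "(\<Sum>t=1..n. \<Sum>z\<in>directions K. z $ i * step_law K p (x t) z) = (\<Sum>t=1..n. a * x t $ i)"
    using x by (intro sum.cong mean) (auto simp: paths_def)
  also have "prob ?E * (\<theta> / n * \<dots> + (1 - \<theta>) * (\<Sum>z\<in>directions K. z $ i * step_law K p (axis i1 1) z))
      = prob ?E * c"
    by (simp only: mean[OF axis_in_directions] c_def)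
  also have "\<dots> = (\<integral>\<omega>\<in>?E. c \<partial>M)"
    by (simp add: set_lebesgue_integral_def)
  also have "\<dots> = (\<integral>\<omega>\<in>?E. drift i n \<omega> \<partial>M)"
  proof (rule set_lebesgue_integral_cong)
    have "drift i n \<omega> = c" if "\<omega> \<in> ?E" for \<omega>
    proof -
      have "position X n \<omega> $ i = (\<Sum>t=1..n. x t $ i)"
        using that by (simp add: position_def sum_component cylinder_def)
      then show ?thesis
        using n by (simp add: drift_def c_def sum_distrib_left[symmetric])
    qed
    then show "\<forall>\<omega>. \<omega> \<in> ?E \<longrightarrow> c = drift i n \<omega>" by simp
  qed simp
  finally show ?thesis .
qed

lemma integrable_drift: "integrable M (drift i n)"
  using abs_drift_le_2 measurable_from_subalg[OF subalgebra_F drift_measurable_F]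
  by (intro integrable_const_bound[where B=2]) (auto intro!: AE_I2)

text \<open>Each event of \<open>F n\<close> is a disjoint union of finitely many cylinders. At n =
  0 every cylinder is the whole space and \<open>drift\<close> is the mean by definition.\<close>

lemma drift_conditional_mean:
  assumes A: "A \<in> sets (F n)"
  shows "(\<integral>\<omega>\<in>A. X (Suc n) \<omega> $ i \<partial>M) = (\<integral>\<omega>\<in>A. drift i n \<omega> \<partial>M)"
proof -
  obtain B where A_eq: "A = history n -` B \<inter> space M"
    using A by (auto simp: sets_F_eq)
  have un: "A = (\<Union>x\<in>paths n \<inter> B. cylinder n x)"
    using history_in_paths by (auto simp: A_eq cylinder_eq_vimage)
  have disj: "disjoint_family_on (cylinder n) (paths n \<inter> B)"
    by (auto simp: disjoint_family_on_def cylinder_eq_vimage)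
  have int: "set_integrable M (cylinder n x) f" if "integrable M f" "x \<in> paths n" for x and f :: "'w \<Rightarrow> real"
    unfolding set_integrable_def using that by (intro integrable_mult_indicator) auto
  have split: "(\<integral>\<omega>\<in>A. f \<omega> \<partial>M) = (\<Sum>x\<in>paths n \<inter> B. \<integral>\<omega>\<in>cylinder n x. f \<omega> \<partial>M)"
    if "integrable M f" for f :: "'w \<Rightarrow> real"
    unfolding un using that disj finite_paths
    by (intro set_integral_finite_Union) (auto intro: int)
  show ?thesis
  proof (cases "n = 0")
    case True
    have path_0: "cylinder n x = space M" for x
      using True by (auto simp: cylinder_def)
    show ?thesis
      unfolding split[OF integrable_X_component[of "Suc n" i, simplified]] split[OF integrable_drift] path_0
      using True by (simp add: set_lebesgue_integral_def drift_def prob_space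
          cong: Bochner_Integration.integral_cong)
  next
    case False
    then show ?thesis
      unfolding split[OF integrable_X_component[of "Suc n" i, simplified]] split[OF integrable_drift]
      by (intro sum.cong drift_cylinder) auto
  qed
qed

text \<open>The constant 3 is 1 for the step plus 2 for the drift.\<close>

lemma abs_innovation_le: "\<omega> \<in> space M \<Longrightarrow> \<bar>innovation i n \<omega>\<bar> \<le> 3 / scale (Suc n)"
  using abs_X_le_1[of "Suc n" \<omega> i] abs_drift_le_2[of \<omega> i n] scale_pos[of "Suc n"]
  by (auto simp: innovation_def abs_divide intro!: divide_right_mono)

lemma innovation_square_le: "\<omega> \<in> space M \<Longrightarrow> (innovation i n \<omega>)\<^sup>2 \<le> 9 * (1 / (scale (Suc n))\<^sup>2)"
  using power_mono[OF abs_innovation_le[of \<omega> i n], of 2] by (simp add: power_divide)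

lemma integrable_innovation_square: "integrable M (\<lambda>\<omega>. (innovation i n \<omega>)\<^sup>2)"
  using innovation_square_le[of _ i n] measurable_from_subalg[OF subalgebra_F innovation_measurable_F, of i n]
  by (intro integrable_const_bound[where B="9 * (1 / (scale (Suc n))\<^sup>2)"]) (auto intro!: AE_I2)

lemma martingale_innovation: "square_summable_martingale_differences M F (innovation i)"
proof unfold_locales
  fix n and A assume A: "A \<in> sets (F n)"
  then have ev: "A \<in> events" using subalgebra_F[of n] by (auto simp: subalgebra_def)
  have int: "set_integrable M A f" if "integrable M f" for f :: "'w \<Rightarrow> real"
    unfolding set_integrable_def using ev that by (rule integrable_mult_indicator)
  have "(\<integral>\<omega>\<in>A. innovation i n \<omega> \<partial>M)
      = ((\<integral>\<omega>\<in>A. X (Suc n) \<omega> $ i \<partial>M) - (\<integral>\<omega>\<in>A. drift i n \<omega> \<partial>M)) / scale (Suc n)"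
    unfolding innovation_def
    by (subst set_integral_diff(2)[symmetric])
       (auto intro!: int integrable_X_component integrable_drift)
  then show "(\<integral>\<omega>\<in>A. innovation i n \<omega> \<partial>M) = 0"
    using drift_conditional_mean[OF A, of i] by simp
next
  show "summable (\<lambda>k. \<integral>\<omega>. (innovation i k \<omega>)\<^sup>2 \<partial>M)"
  proof (rule summable_comparison_test')
    show "summable (\<lambda>k. 9 * (1 / (scale (Suc k))\<^sup>2))"
      by (intro summable_mult summable_Suc_iff[THEN iffD2] summable_inverse_scale_square)
    fix n
    have "(\<integral>\<omega>. (innovation i n \<omega>)\<^sup>2 \<partial>M) \<le> (\<integral>\<omega>. 9 * (1 / (scale (Suc n))\<^sup>2) \<partial>M)"
      by (intro integral_mono integrable_innovation_square innovation_square_le) auto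
    then show "norm (\<integral>\<omega>. (innovation i n \<omega>)\<^sup>2 \<partial>M) \<le> 9 * (1 / (scale (Suc n))\<^sup>2)"
      by (simp add: prob_space)
  qed
qed (rule subalgebra_F F_Suc innovation_measurable_F integrable_innovation_square)+

text \<open>One martingale per coordinate over a common filtration; the constants of the abstract
  part take the coordinate i as first argument.\<close>

sublocale mart: square_summable_martingale_differences M F "innovation i" for i
  by (rule martingale_innovation)

section \<open>The centered position as a martingale\<close>

lemma integrable_X: "n \<ge> 1 \<Longrightarrow> integrable M (X n)"
proof (rule integrable_const_bound)
  assume n: "n \<ge> 1"
  show "X n \<in> borel_measurable M"
    using X_directions[OF n] by (rule measurable_compose[where g = "\<lambda>x. x"]) simp
  show "AE \<omega> in M. norm (X n \<omega>) \<le> (\<Sum>i\<in>(UNIV :: 'd set). 1)"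
    using n by (intro AE_I2 order_trans[OF norm_le_l1_cart] sum_mono) (simp add: abs_X_le_1)
qed

lemma centered_component:
  "centered_position M X n \<omega> $ i = (\<Sum>k=1..n. X k \<omega> $ i - (\<integral>\<omega>. X k \<omega> $ i \<partial>M))"
proof -
  have "integral\<^sup>L M (position X n) $ i = (\<integral>\<omega>. position X n \<omega> $ i \<partial>M)"
    unfolding position_def[abs_def]
    by (intro integral_bounded_linear[symmetric] bounded_linear_vec_nth Bochner_Integration.integrable_sum
        integrable_X) simp
  also have "\<dots> = (\<Sum>k=1..n. \<integral>\<omega>. X k \<omega> $ i \<partial>M)"
    unfolding position_def sum_component
    by (intro Bochner_Integration.integral_sum integrable_X_component) simp
  finally show ?thesis
    by (simp add: centered_position_def position_def sum_subtractf)
qed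

lemma mean_X_Suc: "(\<integral>\<omega>. X (Suc n) \<omega> $ i \<partial>M) = (\<integral>\<omega>. drift i n \<omega> \<partial>M)"
  using drift_conditional_mean[of "space M" n i] sets.top[of "F n"]
  by (simp add: space_F set_lebesgue_integral_def cong: Bochner_Integration.integral_cong)

text \<open>The tendency term is constant and cancels against its mean. What remains is proportional
  to the centered position, which produces the factor 1 + b/n.\<close>

lemma drift_minus_mean:
  assumes "n \<ge> 1"
  shows "drift i n \<omega> - (\<integral>\<omega>. X (Suc n) \<omega> $ i \<partial>M) = a * \<theta> / n * centered_position M X n \<omega> $ i"
proof -
  have int: "integrable M (\<lambda>\<omega>. \<Sum>k=1..n. X k \<omega> $ i)"
    by (intro Bochner_Integration.integrable_sum integrable_X_component) simp
  have "(\<integral>\<omega>. X (Suc n) \<omega> $ i \<partial>M) = a * \<theta> / n * (\<integral>\<omega>. (\<Sum>k=1..n. X k \<omega> $ i) \<partial>M) + (1 - \<theta>) * a * axis i1 1 $ i"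
    using assms int unfolding mean_X_Suc drift_def position_def sum_component
    by (simp add: prob_space)
  also have "(\<integral>\<omega>. (\<Sum>k=1..n. X k \<omega> $ i) \<partial>M) = (\<Sum>k=1..n. \<integral>\<omega>. X k \<omega> $ i \<partial>M)"
    by (intro Bochner_Integration.integral_sum integrable_X_component) simp
  finally show ?thesis
    using assms unfolding centered_component
    by (simp add: drift_def position_def sum_component sum_subtractf algebra_simps)
qed

text \<open>Consecutive scaled positions differ by the innovation, by
  \<open>drift_minus_mean\<close> and \<open>scale_Suc\<close>. The passage from 0 to 1 is separate,
  since \<open>drift\<close> at 0 is a mean. The identity is pointwise, with no exceptional null
  set.\<close>

lemma partial_sum_eq_centered: "mart.partial_sum i n \<omega> = centered_position M X n \<omega> $ i / scale n"
proof (induction n)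
  case 0
  show ?case by (simp add: mart.partial_sum_def centered_component)
next
  case (Suc n)
  have centered_Suc: "centered_position M X (Suc n) \<omega> $ i
      = centered_position M X n \<omega> $ i + X (Suc n) \<omega> $ i - (\<integral>\<omega>. X (Suc n) \<omega> $ i \<partial>M)"
    by (simp add: centered_component)
  have partial_sum_Suc: "mart.partial_sum i (Suc n) \<omega> = mart.partial_sum i n \<omega> + innovation i n \<omega>"
    by (simp add: mart.partial_sum_def)
  show ?case
  proof (cases "n = 0")
    case True
    have "innovation i 0 \<omega> = X (Suc 0) \<omega> $ i - (\<integral>\<omega>. X (Suc 0) \<omega> $ i \<partial>M)"
      by (simp add: innovation_def drift_def)
    moreover have "centered_position M X 0 \<omega> $ i = 0"
      by (simp add: centered_component)
    ultimately show ?thesis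
      using partial_sum_Suc centered_Suc Suc True by simp
  next
    case False
    then have n: "n \<ge> 1" by simp
    have "X (Suc n) \<omega> $ i - drift i n \<omega>
        = centered_position M X (Suc n) \<omega> $ i - centered_position M X n \<omega> $ i * (1 + a * \<theta> / n)"
      using centered_Suc drift_minus_mean[OF n, of i \<omega>] by (simp add: algebra_simps)
    moreover have "1 + a * \<theta> / n \<noteq> 0"
      using a_bounds \<theta>_bounds by (smt (verit) divide_nonneg_nonneg mult_nonneg_nonneg of_nat_0_le_iff)
    moreover have "innovation i n \<omega> = (X (Suc n) \<omega> $ i - drift i n \<omega>) / scale (Suc n)"
      by (rule innovation_def)
    ultimately show ?thesis
      unfolding partial_sum_Suc Suc scale_Suc[OF n]
      using scale_pos[of n] by (simp add: diff_divide_distrib)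
  qed
qed

section \<open>The limit vector and the two modes of convergence\<close>

lemma scaled_centered_component:
  "(centered_position M X n \<omega> /\<^sub>R (real n powr (a * \<theta>))) $ i
    = scale n / real n powr (a * \<theta>) * mart.partial_sum i n \<omega>"
  using scale_pos[of n] by (simp add: partial_sum_eq_centered divide_inverse)

text \<open>With b = a * \<theta> this is 1 / Gamma(1 + b).\<close>

definition limit_factor :: real where
  "limit_factor = inverse (a * \<theta> * Gamma (a * \<theta>))"

lemma limit_factor_pos: "limit_factor > 0"
  using a_bounds \<theta>_bounds by (simp add: limit_factor_def Gamma_real_pos)

lemma scale_div_powr_tendsto: "(\<lambda>n. scale n / real n powr (a * \<theta>)) \<longlonglongrightarrow> limit_factor"
proof -
  have "a * \<theta> * Gamma (a * \<theta>) \<noteq> 0"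
    using limit_factor_pos by (auto simp: limit_factor_def)
  from tendsto_inverse[OF powr_div_scale_tendsto this] show ?thesis
    unfolding limit_factor_def inverse_divide .
qed

definition L :: "'w \<Rightarrow> real ^ 'd" where
  "L \<omega> = (\<chi> i. limit_factor * mart.sum_limit i \<omega>)"

lemma L_measurable: "L \<in> borel_measurable M"
proof (subst borel_measurable_euclidean_space, rule ballI)
  fix b :: "real ^ 'd" assume "b \<in> Basis"
  then obtain i where "b = axis i 1" by (auto simp: Basis_vec_def)
  then show "(\<lambda>\<omega>. L \<omega> \<bullet> b) \<in> borel_measurable M"
    by (simp add: L_def inner_axis)
qed

lemma AE_scaled_tendsto:
  "AE \<omega> in M. (\<lambda>n. centered_position M X n \<omega> /\<^sub>R (real n powr (a * \<theta>))) \<longlonglongrightarrow> L \<omega>"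
proof -
  have "AE \<omega> in M. \<forall>i\<in>(UNIV :: 'd set). (\<lambda>n. mart.partial_sum i n \<omega>) \<longlonglongrightarrow> mart.sum_limit i \<omega>"
    by (rule AE_finite_allI) (auto intro: mart.AE_partial_sum_tendsto)
  then show ?thesis
  proof eventually_elim
    case (elim \<omega>)
    show ?case
    proof (rule vec_tendstoI)
      fix i
      show "(\<lambda>n. (centered_position M X n \<omega> /\<^sub>R (real n powr (a * \<theta>))) $ i) \<longlonglongrightarrow> L \<omega> $ i"
        unfolding scaled_centered_component L_def vec_lambda_beta
        using elim by (intro tendsto_mult scale_div_powr_tendsto) simp
    qed
  qed
qed

text \<open>Two errors occur in each coordinate: the martingale differs from its limit, and the
  ratio \<open>r n\<close> from \<open>limit_factor\<close>. The tail variance controls the first,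
  the finite second moment of the limit the second.\<close>

lemma scaled_tendsto_L2:
  "(\<lambda>n. \<integral>\<^sup>+ \<omega>. ennreal ((norm (centered_position M X n \<omega> /\<^sub>R (real n powr (a * \<theta>)) - L \<omega>))\<^sup>2) \<partial>M)
    \<longlonglongrightarrow> 0"
proof -
  define r where "r n = scale n / real n powr (a * \<theta>)" for n
  define v where "v i = (\<integral>\<omega>. (mart.sum_limit i \<omega>)\<^sup>2 \<partial>M)" for i
  \<comment> \<open>The error is split by inserting \<open>r n\<close> times the limit; the factors
    2 come from (s + t)^2 \<le> 2 s^2 + 2 t^2.\<close>
  define B where "B n = (\<Sum>i\<in>UNIV. 2 * (r n)\<^sup>2 * mart.tail_variance i n + 2 * (r n - limit_factor)\<^sup>2 * v i)" for n
  have bound: "(\<integral>\<^sup>+ \<omega>. ennreal ((norm (centered_position M X n \<omega> /\<^sub>R (real n powr (a * \<theta>)) - L \<omega>))\<^sup>2) \<partial>M)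
      \<le> ennreal (B n)" for n
  proof -
    have pointwise: "(r n * x - limit_factor * y)\<^sup>2 \<le> 2 * (r n)\<^sup>2 * (x - y)\<^sup>2 + 2 * (r n - limit_factor)\<^sup>2 * y\<^sup>2" for x y
    proof -
      have "r n * x - limit_factor * y = r n * (x - y) + (r n - limit_factor) * y"
        by (simp add: algebra_simps)
      moreover have "(s + t)\<^sup>2 \<le> 2 * s\<^sup>2 + 2 * t\<^sup>2" for s t :: real
        using sum_squares_bound[of s t] by (simp add: power2_sum)
      ultimately show ?thesis
        by (simp only: power_mult_distrib[symmetric] mult.assoc)
    qed
    have tail_nonneg: "0 \<le> mart.tail_variance i n" for i
      using mart.tail_variance_ge[where m = n and n = n and i = i] by simp
    have v_nonneg: "0 \<le> v i" for i by (simp add: v_def)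
    have "(\<integral>\<^sup>+ \<omega>. ennreal ((norm (centered_position M X n \<omega> /\<^sub>R (real n powr (a * \<theta>)) - L \<omega>))\<^sup>2) \<partial>M)
        = (\<integral>\<^sup>+ \<omega>. (\<Sum>i\<in>UNIV. ennreal ((r n * mart.partial_sum i n \<omega> - limit_factor * mart.sum_limit i \<omega>)\<^sup>2)) \<partial>M)"
      unfolding power2_norm_eq_inner inner_vec_def vector_minus_component scaled_centered_component L_def
      by (simp add: r_def power2_eq_square)
    also have "\<dots> = (\<Sum>i\<in>UNIV. \<integral>\<^sup>+ \<omega>. ennreal ((r n * mart.partial_sum i n \<omega> - limit_factor * mart.sum_limit i \<omega>)\<^sup>2) \<partial>M)"
      by (rule nn_integral_sum) measurable
    also have "\<dots> \<le> (\<Sum>i\<in>UNIV. ennreal (2 * (r n)\<^sup>2 * mart.tail_variance i n + 2 * (r n - limit_factor)\<^sup>2 * v i))"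
    proof (rule sum_mono)
      fix i :: 'd
      have "(\<integral>\<^sup>+ \<omega>. ennreal ((r n * mart.partial_sum i n \<omega> - limit_factor * mart.sum_limit i \<omega>)\<^sup>2) \<partial>M)
          \<le> (\<integral>\<^sup>+ \<omega>. ennreal (2 * (r n)\<^sup>2) * ennreal ((mart.partial_sum i n \<omega> - mart.sum_limit i \<omega>)\<^sup>2)
              + ennreal (2 * (r n - limit_factor)\<^sup>2) * ennreal ((mart.sum_limit i \<omega>)\<^sup>2) \<partial>M)"
        using pointwise
        by (intro nn_integral_mono) (simp add: ennreal_mult[symmetric] ennreal_plus[symmetric] ennreal_leI del: ennreal_plus)
      also have "\<dots> = ennreal (2 * (r n)\<^sup>2) * (\<integral>\<^sup>+ \<omega>. ennreal ((mart.partial_sum i n \<omega> - mart.sum_limit i \<omega>)\<^sup>2) \<partial>M)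
          + ennreal (2 * (r n - limit_factor)\<^sup>2) * (\<integral>\<^sup>+ \<omega>. ennreal ((mart.sum_limit i \<omega>)\<^sup>2) \<partial>M)"
        by (simp add: nn_integral_add nn_integral_cmult)
      also have "\<dots> \<le> ennreal (2 * (r n)\<^sup>2) * ennreal (mart.tail_variance i n)
          + ennreal (2 * (r n - limit_factor)\<^sup>2) * ennreal (v i)"
        unfolding v_def using nn_integral_eq_integral[OF mart.sum_limit_square_integrable[of i]]
        by (intro add_mono mult_left_mono mart.sum_limit_L2_bound) auto
      also have "\<dots> = ennreal (2 * (r n)\<^sup>2 * mart.tail_variance i n + 2 * (r n - limit_factor)\<^sup>2 * v i)"
        using tail_nonneg v_nonneg by (simp add: ennreal_mult[symmetric] ennreal_plus[symmetric] del: ennreal_plus)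
      finally show "(\<integral>\<^sup>+ \<omega>. ennreal ((r n * mart.partial_sum i n \<omega> - limit_factor * mart.sum_limit i \<omega>)\<^sup>2) \<partial>M)
          \<le> ennreal (2 * (r n)\<^sup>2 * mart.tail_variance i n + 2 * (r n - limit_factor)\<^sup>2 * v i)" .
    qed
    also have "\<dots> = ennreal (B n)"
      unfolding B_def using tail_nonneg v_nonneg by (intro sum_ennreal) auto
    finally show ?thesis .
  qed
  have r: "r \<longlonglongrightarrow> limit_factor"
    unfolding r_def using scale_div_powr_tendsto .
  have "B \<longlonglongrightarrow> (\<Sum>i\<in>(UNIV :: 'd set). 2 * limit_factor\<^sup>2 * 0 + 2 * (limit_factor - limit_factor)\<^sup>2 * v i)"
    unfolding B_def by (intro tendsto_intros r mart.tail_variance_tendsto)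
  then have "(\<lambda>n. ennreal (B n)) \<longlonglongrightarrow> 0"
    using tendsto_ennrealI[of B 0] by simp
  from tendsto_sandwich[OF _ _ tendsto_const this] show ?thesis
    using bound by (auto intro!: always_eventually)
qed

text \<open>All innovations vanish almost surely, so the first two steps are constants v and w, and
  every direction other than w has probability 0 as second step. Testing suitable directions forces
  p = 1, and also \<theta> = 1 unless v is the preferred direction.\<close>

lemma L_constant_imp_deterministic:
  assumes "AE \<omega> in M. L \<omega> = c"
  shows "deterministic_case M p \<theta> i1 X"
proof -
  have innovation_0: "AE \<omega> in M. \<forall>i\<in>(UNIV :: 'd set). innovation i k \<omega> = 0" for k
  proof (rule AE_finite_allI)
    fix i
    have "AE \<omega> in M. mart.sum_limit i \<omega> = c $ i / limit_factor"
      using assms by eventually_elim (use limit_factor_pos in \<open>auto simp: L_def\<close>)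
    then show "AE \<omega> in M. innovation i k \<omega> = 0"
      by (rule mart.sum_limit_constant_imp_D_zero)
  qed simp
  define v where "v = (\<chi> i. \<integral>\<omega>. X 1 \<omega> $ i \<partial>M)"
  \<comment> \<open>The value of \<open>drift\<close> at time 1 when \<open>X 1\<close> is
    v.\<close>
  define w where "w = (\<chi> i. a * \<theta> * v $ i + (1 - \<theta>) * a * axis i1 1 $ i)"
  have X1: "AE \<omega> in M. X 1 \<omega> = v"
    using innovation_0[of 0] by eventually_elim (simp add: innovation_def drift_def v_def vec_eq_iff)
  have X2: "AE \<omega> in M. X 2 \<omega> = w"
    using innovation_0[of 1] X1
  proof eventually_elim
    case (elim \<omega>)
    have "X 2 \<omega> $ i = w $ i" for i
      using elim scale_pos[of 2] by (auto simp: innovation_def drift_def position_def w_def numeral_2_eq_2)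
    then show ?case by (simp add: vec_eq_iff)
  qed
  have "AE \<omega> in M. v \<in> directions K"
    using X1 AE_space by eventually_elim (use X_in_directions in force)
  then have v: "v \<in> directions K" by (simp add: AE_const)
  define x where "x = (\<lambda>i\<in>{1..1::nat}. v)"
  have x: "x \<in> paths 1" using v by (simp add: x_def paths_def)
  have "prob (cylinder 1 x) = 1"
    using X1 AE_space cylinder_in_events[OF x]
    by (subst prob_eq_1) (auto elim!: AE_mp simp: cylinder_def x_def)
  then have step: "prob (cylinder 1 x \<inter> {\<omega>\<in>space M. X 2 \<omega> = z})
      = \<theta> * step_law K p v z + (1 - \<theta>) * step_law K p (axis i1 1) z" if "z \<in> directions K" for z
    using step_probability[of 1 x z] that x \<theta>_bounds by (simp add: x_def numeral_2_eq_2)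
  have zero: "\<theta> * step_law K p v z + (1 - \<theta>) * step_law K p (axis i1 1) z = 0"
    if "z \<in> directions K" "z \<noteq> w" for z
  proof -
    have "prob (cylinder 1 x \<inter> {\<omega>\<in>space M. X 2 \<omega> = z}) = prob {}"
      using X2 that(2) cylinder_in_events[OF x] X_eq_in_events[of 2 z]
      by (intro finite_measure_eq_AE) (auto elim!: AE_mp)
    then show ?thesis using step[OF that(1)] by simp
  qed
  \<comment> \<open>For p = 0 the parameter a would be negative.\<close>
  have p: "p > 0"
    using a_bounds(1) p_bounds K_ge_2 unfolding a_eq by (cases "p = 0") auto
  have step_nonneg: "0 \<le> step_law K p y z" for y z :: "real ^ 'd"
    using p_bounds K_ge_2 by (simp add: step_law_def)
  \<comment> \<open>Through the memory the second step repeats v with probability at least \<theta>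
    * p > 0.\<close>
  have "v = w"
  proof (rule ccontr)
    assume "v \<noteq> w"
    have "0 < \<theta> * step_law K p v v" using p \<theta>_bounds by (simp add: step_law_def)
    moreover have "0 \<le> (1 - \<theta>) * step_law K p (axis i1 1) v"
      using \<theta>_bounds step_nonneg by simp
    ultimately show False using zero[OF v \<open>v \<noteq> w\<close>] by linarith
  qed
  show ?thesis
  \<comment> \<open>The tested direction is the opposite of the preferred one if v is preferred, and
    the preferred one itself otherwise; in both cases it differs from w = v.\<close>
  proof (cases "v = axis i1 1")
    case True
    have "- axis i1 1 \<noteq> (axis i1 1 :: real ^ 'd)"
      by (simp add: vec_eq_iff axis_def)
    then have "step_law K p (axis i1 1) (- axis i1 1 :: real ^ 'd) = 0"
      using zero[of "- axis i1 1"] True \<open>v = w\<close>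
      by (simp add: uminus_in_directions axis_in_directions algebra_simps)
    then have "p = 1"
      using \<open>- axis i1 1 \<noteq> (axis i1 1 :: real ^ 'd)\<close> K_ge_2 by (simp add: step_law_def)
    then show ?thesis using X1 True by (simp add: deterministic_case_def)
  next
    case False
    then have "\<theta> * ((1 - p) / (real K - 1)) + (1 - \<theta>) * p = 0"
      using zero[of "axis i1 1"] \<open>v = w\<close> by (simp add: axis_in_directions step_law_def)
    moreover have "0 \<le> \<theta> * ((1 - p) / (real K - 1))" "0 \<le> (1 - \<theta>) * p"
      using \<theta>_bounds p_bounds K_ge_2 by auto
    ultimately have "\<theta> * ((1 - p) / (real K - 1)) = 0" "(1 - \<theta>) * p = 0" by linarith+
    then have "p = 1" "\<theta> = 1"
      using \<theta>_bounds p K_ge_2 by auto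
    moreover have "\<not> nondegenerate M (X 1)"
      using X1 unfolding nondegenerate_def by blast
    ultimately show ?thesis
      by (simp add: deterministic_case_def)
  qed
qed

end

theorem theorem2p3:
  fixes M :: "'w measure" and K :: nat and p \<theta> a :: real and i1 :: "'d::finite"
    and X :: "nat \<Rightarrow> 'w \<Rightarrow> real ^ 'd" and Y :: "nat \<Rightarrow> 'w \<Rightarrow> bool" and T :: "nat \<Rightarrow> 'w \<Rightarrow> nat"
  assumes "K \<in> {2 * CARD('d), 2 * CARD('d) + 1}"
    and "0 \<le> p" "p \<le> 1" and "0 < \<theta>" "\<theta> \<le> 1"
    and "memory_tendency_walk M K p \<theta> i1 X Y T"
    and "a = (real K * p - 1) / (real K - 1)"
    and "p > (real K + 2 * \<theta> - 1) / (2 * \<theta> * real K)"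
  shows "\<exists>L :: 'w \<Rightarrow> real ^ 'd.
    L \<in> borel_measurable M \<and>
    (\<not> deterministic_case M p \<theta> i1 X \<longrightarrow> nondegenerate M L) \<and>
    (AE \<omega> in M. (\<lambda>n. centered_position M X n \<omega> /\<^sub>R (real n powr (a * \<theta>))) \<longlonglongrightarrow> L \<omega>) \<and>
    (\<lambda>n. \<integral>\<^sup>+ \<omega>. ennreal ((norm (centered_position M X n \<omega> /\<^sub>R (real n powr (a * \<theta>)) - L \<omega>))\<^sup>2) \<partial>M)
      \<longlonglongrightarrow> 0"
proof -
  have "CARD('d) \<ge> 1" by (simp add: Suc_leI)
  then have K: "K \<ge> 2" using assms(1) by auto
  \<comment> \<open>The threshold for p is the value at which a * \<theta> equals 1/2.\<close>
  have "real K + 2 * \<theta> - 1 < p * (2 * \<theta> * real K)"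
    using assms(4,8) K by (simp add: divide_less_eq)
  then have "real K - 1 < 2 * ((real K * p - 1) * \<theta>)"
    by (simp add: algebra_simps)
  then have "1 / 2 < a * \<theta>"
    using K by (simp add: assms(7) field_simps)
  then interpret superdiffusive_walk M K p \<theta> i1 X Y T a
    using assms K by (intro superdiffusive_walk.intro superdiffusive_walk_axioms.intro)
  show ?thesis
    using L_measurable AE_scaled_tendsto scaled_tendsto_L2 L_constant_imp_deterministic
    by (intro exI[of _ L]) (auto simp: nondegenerate_def)
qed

end
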